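(* Let $R$ be a principal ideal domain with only $d<\infty$ maximal ideals, and let $n\ge 3$. Then $\operatorname{SL}(n,R)$ is normally generated by $\operatorname{EL}(n,R)$, and for any $k\ge 1$, $$\Delta_k(\operatorname{SL}(n,R))\le 12(n-1)\cdot\min\{d,\ k(n+1)\}.$$ In particular $\Delta(\operatorname{SL}(n,R))\le 12d(n-1)$, and thus $\operatorname{SL}(n,R)$ is uniformly bounded.
   Context: $\operatorname{EL}(n,R)$ is the set of all elementary matrices $E_{i,j}(r)=I+re_{i,j}$, $r\in R$, $1\le i\ne j\le n$, where $e_{i,j}$ is the $n\times n$ matrix whose only non-zero entry is a $1$ in position $(i,j)$. A subset $S$ of a group $G$ normally generates $G$ if the normal subgroup of $G$ generated by $S$ is $G$; $G$ is finitely normally generated if some finite $S$ normally generates it. For a normally generating $S$, $\|g\|_S$ is the least $m\ge 0$ such that $g$ is a product of $m$ conjugates in $G$ of elements of $S$ and their inverses, and $\|G\|_S=\sup_{g\in G}\|g\|_S$. Set $\Delta_k(G)=\sup\{\|G\|_S : S \text{ normally generates } G,\ |S|\le k\}$ (with $\sup\emptyset=-\infty$) and $\Delta(G)=\sup\{\|G\|_S : S \text{ finite, normally generates } G\}$. $G$ is uniformly bounded if it is finitely normally generated and $\Delta(G)<\infty$. *)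

theory Defs
  imports
    "Jordan_Normal_Form.VS_Connect"
    "HOL-Algebra.Ring_Divisibility"
    "HOL-Algebra.Coset"
    "HOL-Library.Extended_Real"
begin

section \<open>Conjugation-invariant word norms\<close>

definition normal_closure :: "('g, 'm) monoid_scheme \<Rightarrow> 'g set \<Rightarrow> 'g set" where
  "normal_closure G S = \<Inter> {N. N \<lhd> G \<and> S \<subseteq> N}"

definition normally_generates :: "('g, 'm) monoid_scheme \<Rightarrow> 'g set \<Rightarrow> bool" where
  "normally_generates G S \<longleftrightarrow> S \<subseteq> carrier G \<and> normal_closure G S = carrier G"

definition finitely_normally_generated :: "('g, 'm) monoid_scheme \<Rightarrow> bool" where
  "finitely_normally_generated G \<longleftrightarrow> (\<exists>S. finite S \<and> normally_generates G S)"

definition signed_conjugates :: "('g, 'm) monoid_scheme \<Rightarrow> 'g set \<Rightarrow> 'g set" where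
  "signed_conjugates G S =
     {h \<otimes>\<^bsub>G\<^esub> s \<otimes>\<^bsub>G\<^esub> inv\<^bsub>G\<^esub> h | h s. h \<in> carrier G \<and> s \<in> S \<union> (\<lambda>s. inv\<^bsub>G\<^esub> s) ` S}"

text \<open>If \<open>S\<close> does not normally generate \<open>G\<close>, the least length may fail to exist and the
  value of \<open>conj_norm\<close> is then meaningless; it is only used for normally generating \<open>S\<close>.\<close>

definition conj_norm :: "('g, 'm) monoid_scheme \<Rightarrow> 'g set \<Rightarrow> 'g \<Rightarrow> nat" where
  "conj_norm G S g =
     (LEAST m. \<exists>xs. length xs = m \<and> set xs \<subseteq> signed_conjugates G S
                    \<and> foldr (\<otimes>\<^bsub>G\<^esub>) xs \<one>\<^bsub>G\<^esub> = g)"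

definition conj_diameter :: "('g, 'm) monoid_scheme \<Rightarrow> 'g set \<Rightarrow> ereal" where
  "conj_diameter G S = (SUP g\<in>carrier G. ereal (real (conj_norm G S g)))"

text \<open>The suprema are taken in the extended reals, so that the supremum of the empty set
  is \<open>-\<infinity>\<close>. Finiteness of \<open>S\<close> is stated separately because \<open>card\<close> is \<open>0\<close> on infinite sets.\<close>

definition Delta_k :: "nat \<Rightarrow> ('g, 'm) monoid_scheme \<Rightarrow> ereal" where
  "Delta_k k G = Sup {conj_diameter G S | S. normally_generates G S \<and> finite S \<and> card S \<le> k}"

definition Delta :: "('g, 'm) monoid_scheme \<Rightarrow> ereal" where
  "Delta G = Sup {conj_diameter G S | S. normally_generates G S \<and> finite S}"

definition uniformly_bounded :: "('g, 'm) monoid_scheme \<Rightarrow> bool" where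
  "uniformly_bounded G \<longleftrightarrow> finitely_normally_generated G \<and> Delta G < \<infinity>"

section \<open>The special linear group\<close>

definition SL :: "nat \<Rightarrow> 'a :: comm_ring_1 mat monoid" where
  "SL n = \<lparr>carrier = {A \<in> carrier_mat n n. det A = 1}, monoid.mult = (*), one = 1\<^sub>m n\<rparr>"

lemma group_SL: "group (SL n :: 'a :: comm_ring_1 mat monoid)"
proof (rule groupI)
  fix A :: "'a mat" assume A: "A \<in> carrier (SL n)"
  hence c: "A \<in> carrier_mat n n" and d: "det A = 1" by (auto simp: SL_def)
  have inv: "adj_mat A * A = 1\<^sub>m n" and adj: "adj_mat A \<in> carrier_mat n n"
    using adj_mat[OF c] d by auto
  have "det (adj_mat A) = 1"
    using det_mult[OF adj c] inv d by simp
  then show "\<exists>B\<in>carrier (SL n). B \<otimes>\<^bsub>SL n\<^esub> A = \<one>\<^bsub>SL n\<^esub>"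
    using inv adj by (auto simp: SL_def)
qed (auto simp: SL_def det_mult)

text \<open>Matrix indices range over \<open>{0..<n}\<close>.\<close>

definition unit_matrix :: "nat \<Rightarrow> nat \<Rightarrow> nat \<Rightarrow> 'a :: comm_ring_1 mat" where
  "unit_matrix n i j = mat n n (\<lambda>(k, l). if k = i \<and> l = j then 1 else 0)"

definition EL :: "nat \<Rightarrow> 'a :: comm_ring_1 mat set" where
  "EL n = {1\<^sub>m n + r \<cdot>\<^sub>m unit_matrix n i j | r i j. i < n \<and> j < n \<and> i \<noteq> j}"

end

theory Submission
  imports Defs
begin

text \<open>A principal ideal domain with finitely many maximal ideals has stable range one: for all
  \<open>a, b\<close> some \<open>a + t b\<close> divides both \<open>a\<close> and \<open>b\<close>. Two consequences are used.
  First, up to conjugation three transvections suffice to split off a \<open>1 \<times> 1\<close> block \<open>1\<close> from a matrix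
  in \<open>SL(n, R)\<close>, and every such transvection is conjugate to an elementary matrix; so every matrix is
  a product of \<open>3 (n - 1)\<close> conjugates of elementary matrices.
  Second, if \<open>x\<close> generates the ideal of off-diagonal entries of a column of \<open>A\<close>, a double commutator
  writes \<open>E\<^sub>i\<^sub>j(x r)\<close> as a product of four conjugates of \<open>A\<close> and its inverse. Applied to the \<open>n\<close> columns of
  \<open>A\<close> and to one column of a conjugate of \<open>A\<close> that sees the differences of diagonal entries, this gives
  \<open>n + 1\<close> elements which have a common prime divisor \<open>p\<close> only if \<open>A\<close> is scalar modulo \<open>p\<close>.
  If \<open>S\<close> normally generates, not all of \<open>S\<close> is scalar modulo \<open>p\<close>, so these elements generate the unit
  ideal, and so does a choice of one of them for each of the \<open>d\<close> primes. Hence an elementary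
  matrix needs at most \<open>4 min(d, k (n + 1))\<close> factors.\<close>

section \<open>Principal ideal domains with finitely many maximal ideals\<close>

lemma ideal_class_ring_dvd: "ideal {y. g dvd y} (class_ring :: 'a :: comm_ring_1 ring)"
proof -
  have R: "cring (class_ring :: 'a ring)"
    by (rule class_cring.is_cring)
  have "ideal (PIdl\<^bsub>class_ring\<^esub> g) (class_ring :: 'a ring)"
    by (rule cring.cgenideal_ideal[OF R]) simp
  moreover have "PIdl\<^bsub>class_ring\<^esub> g = {y. g dvd y}"
    by (auto simp: cgenideal_def dvd_def mult.commute)
  ultimately show ?thesis by simp
qed

lemma principal_domain_dvdE:
  assumes "principal_domain (class_ring :: 'a :: idom ring)"
    and "ideal I (class_ring :: 'a ring)"
  obtains g where "I = {y. g dvd y}"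
proof -
  obtain g where "I = PIdl\<^bsub>class_ring\<^esub> g"
    using principal_domain.exists_gen[OF assms] by blast
  then have "I = {y. g dvd y}"
    by (auto simp: cgenideal_def dvd_def mult.commute)
  then show ?thesis by (rule that)
qed

text \<open>A generator of the ideal spanned by \<open>a\<close> and \<open>b\<close> lies in that
  ideal, so it is itself a combination of the two.\<close>

lemma principal_domain_bezout:
  fixes a b :: "'a :: idom"
  assumes "principal_domain (class_ring :: 'a ring)"
  shows "\<exists>u v. u * a + v * b dvd a \<and> u * a + v * b dvd b"
proof -
  let ?I = "{u * a + v * b | u v. True}"
  have "ideal ?I (class_ring :: 'a ring)"
  proof (rule idealI)
    show "subgroup ?I (add_monoid (class_ring :: 'a ring))"
    proof (rule group.subgroupI)
      show "group (add_monoid (class_ring :: 'a ring))"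
        by (rule abelian_group.a_group) (rule class_ring.abelian_group_axioms)
      show "?I \<subseteq> carrier (add_monoid class_ring)" "?I \<noteq> {}" by auto
    next
      fix x assume "x \<in> ?I"
      then obtain u v where x: "x = u * a + v * b" by auto
      have "inv\<^bsub>add_monoid class_ring\<^esub> x = - x"
        using a_inv_def[of "class_ring :: 'a ring", symmetric] class_ring_simps by metis
      also have "\<dots> = (- u) * a + (- v) * b" by (simp add: x)
      finally show "inv\<^bsub>add_monoid class_ring\<^esub> x \<in> ?I" by blast
    next
      fix x y assume "x \<in> ?I" "y \<in> ?I"
      then obtain u v u' v' where "x = u * a + v * b" "y = u' * a + v' * b" by auto
      then have "x + y = (u + u') * a + (v + v') * b" by (simp add: algebra_simps)
      then show "x \<otimes>\<^bsub>add_monoid class_ring\<^esub> y \<in> ?I" by auto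
    qed
  next
    fix x y assume "x \<in> ?I"
    then obtain u v where x: "x = u * a + v * b" by auto
    then have "y * x = (y * u) * a + (y * v) * b" by (simp add: algebra_simps)
    then show "y \<otimes>\<^bsub>class_ring\<^esub> x \<in> ?I" "x \<otimes>\<^bsub>class_ring\<^esub> y \<in> ?I"
      by (auto simp: mult.commute[of x])
  qed (rule class_ring.ring_axioms)
  then obtain g where g: "?I = {y. g dvd y}"
    by (rule principal_domain_dvdE[OF assms])
  have "g \<in> ?I" unfolding g by simp
  then obtain u v where uv: "g = u * a + v * b" by auto
  have "a = 1 * a + 0 * b" "b = 0 * a + 1 * b" by simp_all
  then have "a \<in> ?I" "b \<in> ?I" by blast+
  then have "g dvd a" "g dvd b" unfolding g by auto
  then show ?thesis using uv by blast
qed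

lemma maximalideal_class_ring_dvd:
  assumes "maximalideal {y. p dvd y} (class_ring :: 'a :: idom ring)"
  shows "\<not> p dvd 1" and "q dvd p \<Longrightarrow> q dvd 1 \<or> p dvd q"
proof -
  interpret maximalideal "{y. p dvd y}" "class_ring :: 'a ring" by fact
  show "\<not> p dvd 1"
  proof
    assume "p dvd 1"
    then have "p dvd y" for y by (rule dvd_trans) simp
    then show False using I_notcarr by simp
  qed
  show "q dvd 1 \<or> p dvd q" if "q dvd p"
  proof -
    have "{y. p dvd y} \<subseteq> {y. q dvd y}" using dvd_trans[OF that] by blast
    then have "{y. q dvd y} = {y. p dvd y} \<or> {y. q dvd y} = carrier (class_ring :: 'a ring)"
      by (rule I_maximal[OF ideal_class_ring_dvd]) simp
    moreover have "q \<in> {y. q dvd y}" by simp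
    ultimately have "q \<in> {y. p dvd y} \<or> {y. q dvd y} = UNIV"
      unfolding class_ring_simps by blast
    then show ?thesis by blast
  qed
qed

text \<open>Zorn's lemma applies to the proper ideals above \<open>I\<close>: by the ascending chain
  condition the union of a nonempty chain is a member of the chain, hence still proper.\<close>

lemma (in noetherian_ring) exists_maximalideal:
  assumes I: "ideal I R" "I \<noteq> carrier R"
  obtains M where "maximalideal M R" "I \<subseteq> M"
proof -
  let ?A = "{J. ideal J R \<and> I \<subseteq> J \<and> J \<noteq> carrier R}"
  have "\<exists>M\<in>?A. \<forall>X\<in>?A. M \<subseteq> X \<longrightarrow> X = M"
  proof (rule subset_Zorn_nonempty)
    show "?A \<noteq> {}" using I by auto
  next
    fix C assume C: "C \<noteq> {}" "subset.chain ?A C"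
    then have "subset.chain {J. ideal J R} C"
      by (auto simp: pred_on.chain_def)
    then have "\<Union>C \<in> C" by (rule ideal_chain_is_trivial[OF C(1)])
    then show "\<Union>C \<in> ?A" using C by (auto simp: pred_on.chain_def)
  qed
  then obtain M where M: "M \<in> ?A" and max: "\<forall>X\<in>?A. M \<subseteq> X \<longrightarrow> X = M"
    by (rule bexE)
  have "maximalideal M R"
  proof (rule maximalidealI)
    show "ideal M R" "carrier R \<noteq> M" using M by auto
    show "J = M \<or> J = carrier R" if "ideal J R" "M \<subseteq> J" for J
      using that M max by (cases "J = carrier R") auto
  qed
  then show ?thesis using M that by blast
qed

text \<open>\<open>P\<close> holds one generator for each maximal ideal, so that the rest of the
  argument speaks of divisibility only. Over a field the sole maximal ideal is zero and
  \<open>P\<close> is \<open>{0}\<close>, which is why members of \<open>P\<close> may be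
  zero.\<close>

locale semilocal_bezout =
  fixes P :: "'a :: idom set"
  assumes bezout: "\<And>a b :: 'a. \<exists>u v. u * a + v * b dvd a \<and> u * a + v * b dvd b"
    and finite_P: "finite P"
    and not_dvd_one: "p \<in> P \<Longrightarrow> \<not> p dvd 1"
    and maximal: "p \<in> P \<Longrightarrow> q dvd p \<Longrightarrow> q dvd 1 \<or> p dvd q"
    and dvd_imp_eq: "p \<in> P \<Longrightarrow> q \<in> P \<Longrightarrow> p dvd q \<Longrightarrow> p = q"
    and non_unit: "\<not> x dvd 1 \<Longrightarrow> \<exists>p\<in>P. p dvd x"
begin

lemma prime_dvd_mult:
  assumes p: "p \<in> P" and "p dvd x * y"
  shows "p dvd x \<or> p dvd y"
proof (rule disjCI)
  assume y: "\<not> p dvd y"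
  obtain u v where uv: "u * p + v * y dvd p" "u * p + v * y dvd y"
    using bezout[of p y] by blast
  have "\<not> p dvd u * p + v * y"
    using uv(2) y dvd_trans by blast
  \<comment> \<open>The greatest common divisor of \<open>p\<close> and \<open>y\<close> divides
    \<open>p\<close> without being a multiple of it, so maximality makes it a unit.\<close>
  then have "u * p + v * y dvd 1"
    using maximal[OF p uv(1)] by blast
  then obtain h where "1 = (u * p + v * y) * h" by (elim dvdE)
  then have "x = x * ((u * p + v * y) * h)" by (metis mult.right_neutral)
  also have "\<dots> = p * (u * x * h) + (x * y) * (v * h)" by (simp add: algebra_simps)
  finally have x: "p * (u * x * h) + (x * y) * (v * h) = x" by (rule sym)
  have "p dvd p * (u * x * h) + (x * y) * (v * h)"
    using assms(2) by (rule dvd_add[OF dvd_triv_left dvd_mult2])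
  then show "p dvd x" unfolding x .
qed

lemma prime_dvd_prod:
  assumes p: "p \<in> P" and "finite Q" "p dvd \<Prod>Q"
  shows "\<exists>q\<in>Q. p dvd q"
  using assms(2,3)
proof (induction Q rule: finite_induct)
  case empty
  then show ?case using not_dvd_one[OF p] by simp
next
  case (insert q Q)
  then show ?case using prime_dvd_mult[OF p, of q "\<Prod>Q"] by auto
qed

text \<open>With \<open>t\<close> the product of the members of \<open>P\<close> that do not divide
  \<open>a\<close>, each \<open>p\<close> in \<open>P\<close> divides exactly one of
  \<open>a\<close> and \<open>t * b\<close>. So none divides the sum, which is therefore a
  unit.\<close>

lemma unit_combination:
  fixes a b :: 'a
  assumes "u * a + v * b = 1"
  shows "\<exists>t. a + t * b dvd 1"
proof -
  define t where "t = \<Prod>{p \<in> P. \<not> p dvd a}"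
  have "\<not> p dvd a + t * b" if p: "p \<in> P" for p
  proof (cases "p dvd a")
    case True
    have "\<not> p dvd b"
    proof
      assume "p dvd b"
      then have "p dvd u * a + v * b" using True by (intro dvd_add dvd_mult)
      then show False using assms not_dvd_one[OF p] by simp
    qed
    moreover have "\<not> p dvd t"
    proof
      assume "p dvd t"
      then obtain q where "q \<in> P" "\<not> q dvd a" "p dvd q"
        using prime_dvd_prod[OF p, of "{p \<in> P. \<not> p dvd a}"] finite_P by (auto simp: t_def)
      then show False using dvd_imp_eq[OF p] True by blast
    qed
    ultimately have "\<not> p dvd t * b" using prime_dvd_mult[OF p] by blast
    then show ?thesis using True dvd_add_right_iff by blast
  next
    case False
    then have "p dvd t"
      unfolding t_def using finite_P p by (intro dvd_prod_eqI[OF _ _ refl]) auto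
    then show ?thesis using False dvd_add_left_iff dvd_mult2 by blast
  qed
  then have "a + t * b dvd 1" using non_unit[of "a + t * b"] by blast
  then show ?thesis by (rule exI)
qed

text \<open>Dividing by a greatest common divisor \<open>g\<close> reduces to
  \<open>unit_combination\<close>; \<open>g = 0\<close> forces both elements to vanish.\<close>

lemma stable_range:
  fixes a b :: 'a
  shows
  "\<exists>t. a + t * b dvd a \<and> a + t * b dvd b"
proof -
  obtain u v where g: "u * a + v * b dvd a" "u * a + v * b dvd b" using bezout[of a b] by blast
  define g where "g = u * a + v * b"
  show ?thesis
  proof (cases "g = 0")
    case True
    then have "a = 0" "b = 0" using g unfolding g_def[symmetric] by simp_all
    then show ?thesis by simp
  next
    case False
    obtain a' b' where ab: "a = g * a'" "b = g * b'"
      using g unfolding g_def[symmetric] by (elim dvdE)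
    have "g * (u * a' + v * b') = g * 1"
      using g_def by (simp add: ab algebra_simps)
    then have "u * a' + v * b' = 1" using mult_left_cancel[OF False] by blast
    then obtain t where "a' + t * b' dvd 1" using unit_combination[of u a' v b'] by blast
    then have "g * (a' + t * b') dvd g * 1" by (rule mult_dvd_mono[OF dvd_refl])
    moreover have "a + t * b = g * (a' + t * b')" by (simp add: ab algebra_simps)
    ultimately have "a + t * b dvd g" by simp
    then show ?thesis using g unfolding g_def[symmetric] by (meson dvd_trans)
  qed
qed

text \<open>The \<open>v i\<close> are absorbed one at a time: each new combination divides the
  previous one, hence all that the previous one divided.\<close>

lemma stable_range_finite:
  fixes a :: 'a and v :: "'i \<Rightarrow> 'a"
  assumes "finite I"
  shows "\<exists>t. a + (\<Sum>i\<in>I. t i * v i) dvd a \<and> (\<forall>i\<in>I. a + (\<Sum>i\<in>I. t i * v i) dvd v i)"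
  using assms
proof (induction I rule: finite_induct)
  case empty
  then show ?case by simp
next
  case (insert j I)
  then obtain t where t: "a + (\<Sum>i\<in>I. t i * v i) dvd a"
    "\<forall>i\<in>I. a + (\<Sum>i\<in>I. t i * v i) dvd v i" by blast
  define x where "x = a + (\<Sum>i\<in>I. t i * v i)"
  obtain s where s: "x + s * v j dvd x" "x + s * v j dvd v j" using stable_range[of x "v j"] by blast
  have "(\<Sum>i\<in>I. (t(j := s)) i * v i) = (\<Sum>i\<in>I. t i * v i)"
    using insert by (intro sum.cong) auto
  then have "a + (\<Sum>i\<in>insert j I. (t(j := s)) i * v i) = x + s * v j"
    using insert by (simp add: x_def algebra_simps)
  moreover have "x + s * v j dvd a"
    using s(1) t(1) unfolding x_def[symmetric] by (rule dvd_trans)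
  moreover have "x + s * v j dvd v i" if "i \<in> insert j I" for i
    using s t(2) that dvd_trans[OF s(1)] unfolding x_def[symmetric] by blast
  ultimately show ?case by metis
qed

end

lemma principal_domain_semilocal_bezout:
  fixes Ms :: "'a :: idom set set"
  defines "Ms \<equiv> {M. maximalideal M (class_ring :: 'a ring)}"
  assumes pid: "principal_domain (class_ring :: 'a ring)" and fin: "finite Ms"
  obtains P :: "'a set" where "semilocal_bezout P" "card P \<le> card Ms"
proof -
  define gen where "gen M = (SOME p :: 'a. M = {y. p dvd y})" for M
  have gen: "M = {y. gen M dvd y}" if "M \<in> Ms" for M
  proof -
    have "ideal M (class_ring :: 'a ring)"
      using that unfolding Ms_def by (auto intro: maximalideal.axioms)
    then show ?thesis
      unfolding gen_def by (rule principal_domain_dvdE[OF pid]) (rule someI)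
  qed
  have max: "maximalideal {y. gen M dvd y} (class_ring :: 'a ring)" if "M \<in> Ms" for M
    using gen[OF that] that by (simp add: Ms_def)
  have "semilocal_bezout (gen ` Ms)"
  proof
    fix x :: 'a
    assume x: "\<not> x dvd 1"
    interpret principal_domain "class_ring :: 'a ring" by fact
    obtain M where M: "maximalideal M (class_ring :: 'a ring)" "{y. x dvd y} \<subseteq> M"
      by (rule exists_maximalideal[OF ideal_class_ring_dvd, of x]) (use x in auto)
    then have "x \<in> M" "M \<in> Ms" by (auto simp: Ms_def)
    then show "\<exists>p\<in>gen ` Ms. p dvd x" using gen by blast
  next
    fix p q assume "p \<in> gen ` Ms" "q \<in> gen ` Ms" and dvd: "p dvd q"
    then obtain M N where MN: "M \<in> Ms" "p = gen M" "N \<in> Ms" "q = gen N" by auto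
    \<comment> \<open>By maximality of \<open>q\<close> its divisor \<open>p\<close> is a unit,
      which is excluded, or a multiple of \<open>q\<close>. The two ideals then coincide, and
      \<open>gen\<close> picks one generator for each ideal.\<close>
    have "q dvd p"
      using maximalideal_class_ring_dvd[OF max[OF MN(3)]]
        maximalideal_class_ring_dvd(1)[OF max[OF MN(1)]] dvd MN by blast
    then have "{y. p dvd y} = {y. q dvd y}" using dvd dvd_trans by blast
    then show "p = q" using gen[OF MN(1)] gen[OF MN(3)] MN by metis
  next
    fix p assume "p \<in> gen ` Ms"
    then obtain M where M: "M \<in> Ms" "p = gen M" by auto
    show "\<not> p dvd 1" using maximalideal_class_ring_dvd(1)[OF max] M by blast
    show "q dvd p \<Longrightarrow> q dvd 1 \<or> p dvd q" for q
      using maximalideal_class_ring_dvd(2)[OF max] M by blast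
  qed (use principal_domain_bezout[OF pid] fin in auto)
  then show ?thesis using that card_image_le[OF fin] by blast
qed

section \<open>Balls of a conjugation-invariant word norm\<close>

text \<open>Bounding the length, where \<open>conj_norm\<close> minimises over exact lengths, makes
  balls increase with \<open>m\<close>; a bound on \<open>conj_norm\<close> becomes membership in a
  ball.\<close>

definition conj_ball :: "('g, 'm) monoid_scheme \<Rightarrow> 'g set \<Rightarrow> nat \<Rightarrow> 'g set" where
  "conj_ball G S m =
     {g. \<exists>xs. length xs \<le> m \<and> set xs \<subseteq> signed_conjugates G S \<and> foldr (\<otimes>\<^bsub>G\<^esub>) xs \<one>\<^bsub>G\<^esub> = g}"

lemma signed_conjugatesI:
  assumes "g = h \<otimes>\<^bsub>G\<^esub> s \<otimes>\<^bsub>G\<^esub> inv\<^bsub>G\<^esub> h" "s \<in> S \<union> (\<lambda>s. inv\<^bsub>G\<^esub> s) ` S" "h \<in> carrier G"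
  shows "g \<in> signed_conjugates G S"
  using assms unfolding signed_conjugates_def by blast

lemma conj_ballI:
  assumes "length xs \<le> m" "set xs \<subseteq> signed_conjugates G S"
    "foldr (\<otimes>\<^bsub>G\<^esub>) xs \<one>\<^bsub>G\<^esub> = g"
  shows "g \<in> conj_ball G S m"
  using assms unfolding conj_ball_def by blast

lemma conj_ballE:
  assumes "g \<in> conj_ball G S m"
  obtains xs where "length xs \<le> m" "set xs \<subseteq> signed_conjugates G S"
    "g = foldr (\<otimes>\<^bsub>G\<^esub>) xs \<one>\<^bsub>G\<^esub>"
  using assms by (auto simp: conj_ball_def)

lemma conj_ball_mono: "m \<le> m' \<Longrightarrow> conj_ball G S m \<subseteq> conj_ball G S m'"
  unfolding conj_ball_def using le_trans by blast

lemma one_mem_conj_ball: "\<one>\<^bsub>G\<^esub> \<in> conj_ball G S m"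
  by (rule conj_ballI[of "[]"]) auto

lemma conj_norm_le:
  assumes "g \<in> conj_ball G S m"
  shows "conj_norm G S g \<le> m"
proof -
  obtain xs where xs: "length xs \<le> m" "set xs \<subseteq> signed_conjugates G S"
    "g = foldr (\<otimes>\<^bsub>G\<^esub>) xs \<one>\<^bsub>G\<^esub>"
    using assms by (rule conj_ballE)
  have "conj_norm G S g \<le> length xs"
    unfolding conj_norm_def by (rule Least_le) (use xs in blast)
  then show ?thesis using xs(1) by simp
qed

lemma conj_diameter_le:
  assumes "carrier G \<subseteq> conj_ball G S m"
  shows "conj_diameter G S \<le> ereal (real m)"
  unfolding conj_diameter_def
proof (rule SUP_least)
  fix g assume "g \<in> carrier G"
  then have "conj_norm G S g \<le> m" by (rule conj_norm_le[OF subsetD[OF assms]])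
  then show "ereal (real (conj_norm G S g)) \<le> ereal (real m)" by simp
qed

context group
begin

lemma foldr_mult_closed: "set xs \<subseteq> carrier G \<Longrightarrow> foldr (\<otimes>) xs \<one> \<in> carrier G"
  by (induction xs) auto

lemma foldr_mult_append:
  "set xs \<subseteq> carrier G \<Longrightarrow> set ys \<subseteq> carrier G \<Longrightarrow>
    foldr (\<otimes>) (xs @ ys) \<one> = foldr (\<otimes>) xs \<one> \<otimes> foldr (\<otimes>) ys \<one>"
proof (induction xs)
  case Nil
  then show ?case by (simp add: foldr_mult_closed)
next
  case (Cons x xs)
  then show ?case by (simp add: m_assoc foldr_mult_closed del: foldr_append)
qed

lemma foldr_mult_conj:
  assumes "h \<in> carrier G"
  shows "set xs \<subseteq> carrier G \<Longrightarrow>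
    foldr (\<otimes>) (map (\<lambda>x. h \<otimes> x \<otimes> inv h) xs) \<one> = h \<otimes> foldr (\<otimes>) xs \<one> \<otimes> inv h"
proof (induction xs)
  case Nil
  then show ?case using assms by simp
next
  case (Cons x xs)
  then have c: "x \<in> carrier G" "foldr (\<otimes>) xs \<one> \<in> carrier G"
    by (auto intro: foldr_mult_closed)
  have "inv h \<otimes> (h \<otimes> y) = y" if "y \<in> carrier G" for y
    using assms that by (simp add: m_assoc[symmetric])
  then show ?case using Cons assms c by (simp add: m_assoc)
qed

lemma foldr_mult_inv:
  "set xs \<subseteq> carrier G \<Longrightarrow> foldr (\<otimes>) (rev (map (\<lambda>x. inv x) xs)) \<one> = inv (foldr (\<otimes>) xs \<one>)"
proof (induction xs)
  case (Cons x xs)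
  have "foldr (\<otimes>) (rev (map (\<lambda>x. inv x) xs) @ [inv x]) \<one>
      = foldr (\<otimes>) (rev (map (\<lambda>x. inv x) xs)) \<one> \<otimes> foldr (\<otimes>) [inv x] \<one>"
    using Cons.prems by (intro foldr_mult_append) auto
  then show ?case
    using Cons by (simp add: inv_mult_group foldr_mult_closed del: foldr_append)
qed simp

context
  fixes S assumes S: "S \<subseteq> carrier G"
begin

lemma signed_conjugates_closed: "signed_conjugates G S \<subseteq> carrier G"
  using S by (auto simp: signed_conjugates_def)

lemma signed_conjugates_conj:
  assumes "x \<in> signed_conjugates G S" and h: "h \<in> carrier G"
  shows "h \<otimes> x \<otimes> inv h \<in> signed_conjugates G S"
proof -
  obtain k s where x: "x = k \<otimes> s \<otimes> inv k" and k: "k \<in> carrier G"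
    and s: "s \<in> S \<union> (\<lambda>s. inv s) ` S"
    using assms(1) by (auto simp: signed_conjugates_def)
  have "s \<in> carrier G" using s S by auto
  then have "h \<otimes> x \<otimes> inv h = (h \<otimes> k) \<otimes> s \<otimes> inv (h \<otimes> k)"
    using h k by (simp add: x m_assoc inv_mult_group)
  then show ?thesis using s m_closed[OF h k] by (intro signed_conjugatesI)
qed

lemma signed_conjugates_inv:
  assumes "x \<in> signed_conjugates G S"
  shows "inv x \<in> signed_conjugates G S"
proof -
  obtain k s where x: "x = k \<otimes> s \<otimes> inv k" and k: "k \<in> carrier G"
    and s: "s \<in> S \<union> (\<lambda>s. inv s) ` S"
    using assms by (auto simp: signed_conjugates_def)
  have "s \<in> carrier G" using s S by auto
  then have "inv x = k \<otimes> inv s \<otimes> inv k"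
    using k by (simp add: x m_assoc inv_mult_group)
  moreover have "inv s \<in> S \<union> (\<lambda>s. inv s) ` S" using s S by auto
  ultimately show ?thesis using k by (intro signed_conjugatesI)
qed

lemma conj_ball_closed: "conj_ball G S m \<subseteq> carrier G"
  using signed_conjugates_closed foldr_mult_closed by (auto simp: conj_ball_def)

lemma mem_conj_ball:
  assumes "s \<in> S"
  shows "s \<in> conj_ball G S 1"
proof -
  have s: "s \<in> carrier G" using assms S by blast
  then have "s = \<one> \<otimes> s \<otimes> inv \<one>" by simp
  then have "s \<in> signed_conjugates G S"
    using assms by (intro signed_conjugatesI[where h = \<one> and s = s]) auto
  then show ?thesis
    using s by (intro conj_ballI[of "[s]"]) auto
qed

lemma conj_ball_mult:
  assumes "x \<in> conj_ball G S a" "y \<in> conj_ball G S b"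
  shows "x \<otimes> y \<in> conj_ball G S (a + b)"
proof -
  obtain xs where xs: "length xs \<le> a" "set xs \<subseteq> signed_conjugates G S" "x = foldr (\<otimes>) xs \<one>"
    using assms(1) by (rule conj_ballE)
  obtain ys where ys: "length ys \<le> b" "set ys \<subseteq> signed_conjugates G S" "y = foldr (\<otimes>) ys \<one>"
    using assms(2) by (rule conj_ballE)
  have "foldr (\<otimes>) (xs @ ys) \<one> = x \<otimes> y"
    unfolding xs(3) ys(3)
    by (rule foldr_mult_append) (use xs ys signed_conjugates_closed in auto)
  moreover have "length (xs @ ys) \<le> a + b" "set (xs @ ys) \<subseteq> signed_conjugates G S"
    using xs ys by auto
  ultimately show ?thesis by (intro conj_ballI)
qed

lemma conj_ball_conj:
  assumes "x \<in> conj_ball G S a" and h: "h \<in> carrier G"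
  shows "h \<otimes> x \<otimes> inv h \<in> conj_ball G S a"
proof -
  obtain xs where xs: "length xs \<le> a" "set xs \<subseteq> signed_conjugates G S" "x = foldr (\<otimes>) xs \<one>"
    using assms(1) by (rule conj_ballE)
  have "foldr (\<otimes>) (map (\<lambda>x. h \<otimes> x \<otimes> inv h) xs) \<one> = h \<otimes> x \<otimes> inv h"
    unfolding xs(3) by (rule foldr_mult_conj[OF h]) (use xs signed_conjugates_closed in auto)
  moreover have "length (map (\<lambda>x. h \<otimes> x \<otimes> inv h) xs) \<le> a"
    "set (map (\<lambda>x. h \<otimes> x \<otimes> inv h) xs) \<subseteq> signed_conjugates G S"
    using xs signed_conjugates_conj[OF _ h] by auto
  ultimately show ?thesis by (intro conj_ballI)
qed

lemma conj_ball_inv: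
  assumes "x \<in> conj_ball G S a"
  shows "inv x \<in> conj_ball G S a"
proof -
  obtain xs where xs: "length xs \<le> a" "set xs \<subseteq> signed_conjugates G S" "x = foldr (\<otimes>) xs \<one>"
    using assms(1) by (rule conj_ballE)
  have "foldr (\<otimes>) (rev (map (\<lambda>x. inv x) xs)) \<one> = inv x"
    unfolding xs(3) by (rule foldr_mult_inv) (use xs signed_conjugates_closed in auto)
  moreover have "length (rev (map (\<lambda>x. inv x) xs)) \<le> a"
    "set (rev (map (\<lambda>x. inv x) xs)) \<subseteq> signed_conjugates G S"
    using xs signed_conjugates_inv by auto
  ultimately show ?thesis by (intro conj_ballI)
qed

lemma conj_ball_subset_normal:
  assumes N: "N \<lhd> G" and "S \<subseteq> N"
  shows "conj_ball G S m \<subseteq> N"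
proof -
  have sub: "subgroup N G" using N by (rule normal_invE)
  have "signed_conjugates G S \<subseteq> N"
    using assms(2) normal_invE(2)[OF N] subgroup.m_inv_closed[OF sub]
    by (auto simp: signed_conjugates_def)
  moreover have "foldr (\<otimes>) xs \<one> \<in> N" if "set xs \<subseteq> N" for xs
    using that by (induction xs) (auto intro: subgroup.one_closed[OF sub] subgroup.m_closed[OF sub])
  ultimately show ?thesis by (auto simp: conj_ball_def)
qed

text \<open>A normal subgroup containing \<open>S\<close> contains every ball, so a single ball that
  exhausts the group suffices.\<close>

lemma normally_generatesI:
  assumes "carrier G \<subseteq> conj_ball G S m"
  shows "normally_generates G S"
proof -
  have "carrier G \<subseteq> N" if "N \<lhd> G" "S \<subseteq> N" for N
    using assms conj_ball_subset_normal[OF that] by blast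
  moreover have "carrier G \<lhd> G"
    by (rule normal_invI[OF subgroup_self]) simp
  ultimately have "normal_closure G S = carrier G"
    using S unfolding normal_closure_def by blast
  then show ?thesis using S by (simp add: normally_generates_def)
qed

end

lemma normally_generates_mono:
  assumes "normally_generates G S" "S \<subseteq> T" "T \<subseteq> carrier G"
  shows "normally_generates G T"
proof -
  have "normal_closure G S \<subseteq> normal_closure G T"
    using assms(2) unfolding normal_closure_def by blast
  moreover have "normal_closure G T \<subseteq> carrier G"
    using normal_invI[OF subgroup_self] assms(3) unfolding normal_closure_def by auto
  ultimately show ?thesis using assms unfolding normally_generates_def by auto
qed

end

section \<open>Transvections\<close>

text \<open>Vectors are functions on all naturals of which only the values below \<open>n\<close>
  matter; this is the standard basis vector \<open>e_i\<close>.\<close>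

definition std :: "nat \<Rightarrow> nat \<Rightarrow> 'a :: comm_ring_1" where
  "std i k = (if k = i then 1 else 0)"

text \<open>This is the matrix \<open>1 + v w^T\<close>. Orthogonality of \<open>v\<close> and
  \<open>w\<close> is not built in but assumed where inverses are formed.\<close>

definition transv :: "nat \<Rightarrow> (nat \<Rightarrow> 'a) \<Rightarrow> (nat \<Rightarrow> 'a) \<Rightarrow> 'a :: comm_ring_1 mat" where
  "transv n v w = mat n n (\<lambda>(i, j). (if i = j then 1 else 0) + v i * w j)"

lemma std_simps [simp]: "std i i = 1" "k \<noteq> i \<Longrightarrow> std i k = 0"
  by (simp_all add: std_def)

lemma sum_std [simp]:
  assumes "i < n"
  shows "(\<Sum>k<n. std i k * f k) = f i" "(\<Sum>k<n. f k * std i k) = f i"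
proof -
  have "std i k * f k = (if k = i then f k else 0)" "f k * std i k = (if k = i then f k else 0)" for k
    by (simp_all add: std_def)
  then show "(\<Sum>k<n. std i k * f k) = f i" "(\<Sum>k<n. f k * std i k) = f i"
    using assms by simp_all
qed

lemma transv_carrier [simp]: "transv n v w \<in> carrier_mat n n"
  by (simp add: transv_def)

lemma transv_dim [simp]: "dim_row (transv n v w) = n" "dim_col (transv n v w) = n"
  by (simp_all add: transv_def)

lemma transv_index [simp]:
  "i < n \<Longrightarrow> j < n \<Longrightarrow> transv n v w $$ (i, j) = (if i = j then 1 else 0) + v i * w j"
  by (simp add: transv_def)

lemma transv_cong:
  "(\<And>i. i < n \<Longrightarrow> v i = v' i) \<Longrightarrow> (\<And>i. i < n \<Longrightarrow> w i = w' i) \<Longrightarrow>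
    transv n v w = transv n v' w'"
  by (rule eq_matI) auto

lemma transv_uminus: "transv n (\<lambda>i. - v i) w = transv n v (\<lambda>i. - w i)"
  by (rule eq_matI) auto

lemma transpose_transv: "transpose_mat (transv n v w) = transv n w v"
  by (rule eq_matI) (auto simp: mult.commute)

lemma index_mult_mat_sum:
  assumes "A \<in> carrier_mat n n" "B \<in> carrier_mat n n" "i < n" "j < n"
  shows "(A * B) $$ (i, j) = (\<Sum>k<n. A $$ (i, k) * B $$ (k, j))"
  using assms by (simp add: scalar_prod_def atLeast0LessThan)

lemma transv_mult_index:
  assumes "A \<in> carrier_mat n n" "i < n" "j < n"
  shows "(transv n v w * A) $$ (i, j) = A $$ (i, j) + v i * (\<Sum>k<n. w k * A $$ (k, j))"
proof -
  have "(transv n v w * A) $$ (i, j) = (\<Sum>k<n. transv n v w $$ (i, k) * A $$ (k, j))"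
    by (rule index_mult_mat_sum) (use assms in auto)
  also have "\<dots> = (\<Sum>k<n. std i k * A $$ (k, j) + v i * (w k * A $$ (k, j)))"
    by (rule sum.cong) (use assms in \<open>auto simp: std_def algebra_simps\<close>)
  also have "\<dots> = A $$ (i, j) + v i * (\<Sum>k<n. w k * A $$ (k, j))"
    using assms by (simp add: sum.distrib sum_distrib_left)
  finally show ?thesis .
qed

lemma mult_transv_index:
  assumes "A \<in> carrier_mat n n" "i < n" "j < n"
  shows "(A * transv n v w) $$ (i, j) = A $$ (i, j) + (\<Sum>k<n. A $$ (i, k) * v k) * w j"
proof -
  have "(A * transv n v w) $$ (i, j) = (\<Sum>k<n. A $$ (i, k) * transv n v w $$ (k, j))"
    by (rule index_mult_mat_sum) (use assms in auto)
  also have "\<dots> = (\<Sum>k<n. A $$ (i, k) * std j k + (A $$ (i, k) * v k) * w j)"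
    by (rule sum.cong) (use assms in \<open>auto simp: std_def algebra_simps\<close>)
  also have "\<dots> = A $$ (i, j) + (\<Sum>k<n. A $$ (i, k) * v k) * w j"
    using assms by (simp add: sum.distrib sum_distrib_right)
  finally show ?thesis .
qed

lemma sum_transv_col:
  assumes "i < n"
  shows "(\<Sum>k<n. transv n a b $$ (i, k) * v k) = v i + a i * (\<Sum>k<n. b k * v k)"
proof -
  have "(\<Sum>k<n. transv n a b $$ (i, k) * v k) = (\<Sum>k<n. std i k * v k + a i * (b k * v k))"
    by (rule sum.cong) (use assms in \<open>auto simp: std_def algebra_simps\<close>)
  then show ?thesis
    using assms by (simp add: sum.distrib sum_distrib_left)
qed

lemma sum_transv_row:
  assumes "j < n"
  shows "(\<Sum>k<n. w k * transv n a b $$ (k, j)) = w j + (\<Sum>k<n. w k * a k) * b j"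
proof -
  have "(\<Sum>k<n. w k * transv n a b $$ (k, j)) = (\<Sum>k<n. w k * std j k + (w k * a k) * b j)"
    by (rule sum.cong) (use assms in \<open>auto simp: std_def algebra_simps\<close>)
  then show ?thesis
    using assms by (simp add: sum.distrib sum_distrib_right)
qed

text \<open>The only quadratic term is \<open>v (w^T v) w'^T\<close>, which vanishes. In particular
  negating \<open>w\<close> gives the inverse.\<close>

lemma transv_mult_same_left:
  assumes "(\<Sum>k<n. w k * v k) = 0"
  shows "transv n v w * transv n v w' = transv n v (\<lambda>k. w k + w' k)"
proof (rule eq_matI)
  fix i j assume "i < dim_row (transv n v (\<lambda>k. w k + w' k))" "j < dim_col (transv n v (\<lambda>k. w k + w' k))"
  then have ij: "i < n" "j < n" by simp_all
  have "(transv n v w * transv n v w') $$ (i, j) =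
      transv n v w $$ (i, j) + (\<Sum>k<n. transv n v w $$ (i, k) * v k) * w' j"
    by (rule mult_transv_index) (use ij in auto)
  also have "\<dots> = transv n v (\<lambda>k. w k + w' k) $$ (i, j)"
    unfolding sum_transv_col[OF ij(1)] assms using ij by (simp add: algebra_simps)
  finally show "(transv n v w * transv n v w') $$ (i, j) = transv n v (\<lambda>k. w k + w' k) $$ (i, j)" .
qed auto

lemma transv_zero: "transv n v (\<lambda>k. 0) = 1\<^sub>m n"
  by (rule eq_matI) auto

lemma transv_mult_inverse:
  assumes "(\<Sum>k<n. w k * v k) = 0"
  shows "transv n v w * transv n v (\<lambda>k. - w k) = 1\<^sub>m n"
  using transv_mult_same_left[OF assms, of "\<lambda>k. - w k"] by (simp add: transv_zero)

text \<open>A transvection \<open>1 + v w\<^sup>T\<close> is conjugated by \<open>g\<close> to \<open>1 + (g v) (w\<^sup>T g\<^sup>-\<^sup>1)\<close>; the second factor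
  is given implicitly, which avoids inverse matrices.\<close>

lemma conj_transv:
  assumes g: "g \<in> carrier_mat n n" and h: "h \<in> carrier_mat n n" and gh: "g * h = 1\<^sub>m n"
    and v: "\<And>i. i < n \<Longrightarrow> v' i = (\<Sum>k<n. g $$ (i, k) * v k)"
    and w: "\<And>j. j < n \<Longrightarrow> w j = (\<Sum>k<n. w' k * g $$ (k, j))"
  shows "g * transv n v w * h = transv n v' w'"
proof -
  have "g * transv n v w = transv n v' w' * g"
  proof (rule eq_matI)
    fix i j assume "i < dim_row (transv n v' w' * g)" "j < dim_col (transv n v' w' * g)"
    then have ij: "i < n" "j < n" using g by simp_all
    show "(g * transv n v w) $$ (i, j) = (transv n v' w' * g) $$ (i, j)"
      unfolding mult_transv_index[OF g ij] transv_mult_index[OF g ij] v[OF ij(1)] w[OF ij(2)] ..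
  qed (use g in auto)
  then have "g * transv n v w * h = transv n v' w' * (g * h)"
    using assoc_mult_mat[OF transv_carrier g h] by simp
  then show ?thesis by (simp add: gh)
qed

text \<open>The case \<open>g = 1 + a b^T\<close> of \<open>conj_transv\<close>: its inverse
  \<open>1 - a b^T\<close> makes the new row vector explicit. Later conjugations of one transvection
  by another go through this formula.\<close>

lemma conj_transv_transv:
  assumes ab: "(\<Sum>k<n. b k * a k) = 0"
  shows "transv n a b * transv n v w * transv n a (\<lambda>k. - b k) =
    transv n (\<lambda>i. v i + a i * (\<Sum>k<n. b k * v k)) (\<lambda>j. w j - (\<Sum>k<n. w k * a k) * b j)"
    (is "_ = transv n _ ?w")
proof (rule conj_transv)
  fix j assume j: "j < n"
  have "(\<Sum>k<n. (w k - c * b k) * a k) = (\<Sum>k<n. w k * a k) - c * (\<Sum>k<n. b k * a k)" for c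
    by (simp add: algebra_simps sum_subtractf sum_distrib_left)
  then show "w j = (\<Sum>k<n. ?w k * transv n a b $$ (k, j))"
    unfolding sum_transv_row[OF j] by (simp add: ab)
qed (use transv_mult_inverse[OF ab] in \<open>simp_all add: sum_transv_col del: transv_index\<close>)

text \<open>The column is filled from the top, one entry at a time. Row \<open>j\<close> stays
  \<open>e_j\<close> because \<open>v j = 0\<close>, so each new entry arises by adding a multiple
  of row \<open>j\<close> to another row, which keeps the determinant.\<close>

lemma det_transv_col:
  assumes j: "j < n" and v: "v j = 0"
  shows "det (transv n v (std j)) = 1"
proof -
  have "det (transv n (\<lambda>i. if i < k then v i else 0) (std j)) = 1" if "k \<le> n" for k
    using that
  proof (induction k)
    case 0
    have "transv n (\<lambda>i. if i < 0 then v i else 0) (std j) = 1\<^sub>m n"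
      by (rule eq_matI) auto
    then show ?case by simp
  next
    case (Suc k)
    let ?T = "transv n (\<lambda>i. if i < k then v i else 0) (std j)"
    show ?case
    proof (cases "k = j")
      case True
      then have "transv n (\<lambda>i. if i < Suc k then v i else 0) (std j) = ?T"
        using v by (intro transv_cong) (auto simp: less_Suc_eq)
      then show ?thesis using Suc by simp
    next
      case False
      have "transv n (\<lambda>i. if i < Suc k then v i else 0) (std j) = addrow (v k) k j ?T"
        by (rule eq_matI) (use Suc.prems False j v in \<open>auto simp: std_def less_Suc_eq\<close>)
      then show ?thesis
        using det_addrow[OF j False, of ?T "v k"] Suc by simp
    qed
  qed
  from this[of n] show ?thesis
    using transv_cong[of n v "\<lambda>i. if i < n then v i else 0" "std j" "std j"] by simp
qed

lemma det_transv_row: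
  assumes "i < n" "w i = 0"
  shows "det (transv n (std i) w) = 1"
  using det_transv_col[of i n w] assms det_transpose[of "transv n w (std i)" n]
  by (simp add: transpose_transv)

section \<open>The special linear group, elementary matrices and block shapes\<close>

lemma SL_simps [simp]:
  "monoid.mult (SL n) = (*)" "one (SL n) = 1\<^sub>m n"
  by (simp_all add: SL_def)

lemma mem_SL: "A \<in> carrier (SL n) \<longleftrightarrow> A \<in> carrier_mat n n \<and> det A = 1"
  by (simp add: SL_def)

lemma transv_col_SL: "j < n \<Longrightarrow> v j = 0 \<Longrightarrow> transv n v (std j) \<in> carrier (SL n)"
  by (simp add: mem_SL det_transv_col)

lemma transv_row_SL: "i < n \<Longrightarrow> w i = 0 \<Longrightarrow> transv n (std i) w \<in> carrier (SL n)"
  by (simp add: mem_SL det_transv_row)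

lemma SL_inverseE:
  assumes "A \<in> carrier (SL n)"
  obtains B where "B \<in> carrier (SL n)" "A * B = 1\<^sub>m n" "B * A = 1\<^sub>m n"
proof -
  interpret group "SL n :: 'a mat monoid" by (rule group_SL)
  show ?thesis
    using that[of "inv\<^bsub>SL n\<^esub> A"] assms r_inv[OF assms] l_inv[OF assms] by simp
qed

lemma SL_inv_eq:
  assumes "A \<in> carrier (SL n)" "B \<in> carrier (SL n)" "A * B = 1\<^sub>m n"
  shows "inv\<^bsub>SL n\<^esub> A = B"
proof -
  interpret group "SL n :: 'a mat monoid" by (rule group_SL)
  show ?thesis
    using inv_unique'[of A B] inv_comm[of A B] assms by simp
qed

text \<open>Writing an elementary matrix as a transvection brings it under the conjugation formulas;
  the scalar may sit on either vector.\<close>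

definition elementary :: "nat \<Rightarrow> nat \<Rightarrow> nat \<Rightarrow> 'a \<Rightarrow> 'a :: comm_ring_1 mat" where
  "elementary n i j r = transv n (std i) (\<lambda>k. r * std j k)"

lemma elementary_eq_EL: "elementary n i j r = 1\<^sub>m n + r \<cdot>\<^sub>m unit_matrix n i j"
  by (rule eq_matI) (auto simp: elementary_def unit_matrix_def std_def)

lemma elementary_eq_transv_col: "elementary n i j r = transv n (\<lambda>k. r * std i k) (std j)"
  unfolding elementary_def by (rule eq_matI) auto

lemma elementary_add:
  assumes "i < n" "i \<noteq> j"
  shows "elementary n i j (a + b) = elementary n i j a * elementary n i j b"
proof -
  have "(\<Sum>k<n. a * std j k * std i k) = 0"
    using assms by simp
  from transv_mult_same_left[OF this, of "\<lambda>k. b * std j k"] show ?thesis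
    by (simp add: elementary_def distrib_right)
qed

lemma elementary_zero: "elementary n i j 0 = 1\<^sub>m n"
  unfolding elementary_def using transv_zero by simp

lemma EL_subset_SL: "EL n \<subseteq> carrier (SL n)"
  unfolding EL_def elementary_eq_EL[symmetric] by (auto simp: elementary_def intro!: transv_row_SL)

lemma SL_right_inverse:
  assumes "A \<in> carrier (SL n)" "X \<in> carrier_mat n n" "A * X = 1\<^sub>m n"
  shows "X \<in> carrier (SL n)"
  using det_mult[of A n X] assms by (simp add: mem_SL)

text \<open>The block diagonal shape with an identity block of size \<open>m\<close> in front, kept
  inside \<open>n x n\<close> matrices so that the group does not change during the
  reduction.\<close>

definition clean :: "nat \<Rightarrow> nat \<Rightarrow> 'a :: comm_ring_1 mat \<Rightarrow> bool" where
  "clean n m A \<longleftrightarrow> (\<forall>i<n. \<forall>j<n. i < m \<or> j < m \<longrightarrow> A $$ (i, j) = (if i = j then 1 else 0))"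

lemma cleanD:
  "clean n m A \<Longrightarrow> i < n \<Longrightarrow> j < n \<Longrightarrow> i < m \<or> j < m \<Longrightarrow> A $$ (i, j) = (if i = j then 1 else 0)"
  unfolding clean_def by blast

lemma clean_transv:
  assumes "\<And>k. k < m \<Longrightarrow> v k = 0" "\<And>k. k < m \<Longrightarrow> w k = 0"
  shows "clean n m (transv n v w)"
  using assms by (auto simp: clean_def)

lemma clean_mult:
  assumes "A \<in> carrier_mat n n" "B \<in> carrier_mat n n" and A: "clean n m A" and B: "clean n m B"
  shows "clean n m (A * B)"
  unfolding clean_def
proof (intro allI impI)
  fix i j assume ij: "i < n" "j < n" and m: "i < m \<or> j < m"
  have AB: "(A * B) $$ (i, j) = (\<Sum>k<n. A $$ (i, k) * B $$ (k, j))"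
    by (rule index_mult_mat_sum) (use assms ij in auto)
  from m show "(A * B) $$ (i, j) = (if i = j then 1 else 0)"
  proof
    assume i: "i < m"
    have "(\<Sum>k<n. A $$ (i, k) * B $$ (k, j)) = (\<Sum>k<n. std i k * B $$ (k, j))"
      by (rule sum.cong) (use cleanD[OF A ij(1)] i in \<open>auto simp: std_def\<close>)
    then show ?thesis using AB cleanD[OF B ij m] ij cleanD[OF B ij] i by simp
  next
    assume j: "j < m"
    have "(\<Sum>k<n. A $$ (i, k) * B $$ (k, j)) = (\<Sum>k<n. A $$ (i, k) * std j k)"
      by (rule sum.cong) (use cleanD[OF B _ ij(2)] j in \<open>auto simp: std_def\<close>)
    then show ?thesis using AB cleanD[OF A ij] ij j by simp
  qed
qed

text \<open>Such a matrix is diagonal with at most its last entry different from \<open>1\<close>,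
  and that entry equals the determinant.\<close>

lemma clean_SL_eq_one:
  assumes A: "A \<in> carrier (SL n)" and c: "clean n (n - 1) A" and n: "0 < n"
  shows "A = 1\<^sub>m n"
proof -
  have cA: "A \<in> carrier_mat n n" and det: "det A = 1" using A by (simp_all add: mem_SL)
  have d: "A $$ (i, j) = (if i = j then 1 else 0)" if "i < n" "j < n" "i < n - 1 \<or> j < n - 1" for i j
    using cleanD[OF c that] .
  have "A $$ (i, j) = 0" if "j < i" "i < n" for i j
  proof -
    have "j < n - 1" "j < n" using that by linarith+
    then show ?thesis using d[of i j] that by simp
  qed
  then have "upper_triangular A"
    using cA by (auto simp: upper_triangular_def)
  then have "det A = prod_list (diag_mat A)"
    using det_upper_triangular cA by blast
  also have "\<dots> = (\<Prod>i<n. A $$ (i, i))"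
    using cA by (simp add: diag_mat_def prod.distinct_set_conv_list[symmetric] atLeast0LessThan)
  also have "\<dots> = (\<Prod>i<Suc (n - 1). A $$ (i, i))" using n by simp
  also have "\<dots> = (\<Prod>i<n - 1. A $$ (i, i)) * A $$ (n - 1, n - 1)" by simp
  also have "(\<Prod>i<n - 1. A $$ (i, i)) = 1" using d by (intro prod.neutral) simp
  finally have last: "A $$ (n - 1, n - 1) = 1" using det by simp
  show ?thesis
  proof (rule eq_matI)
    fix i j assume "i < dim_row (1\<^sub>m n)" "j < dim_col (1\<^sub>m n)"
    then have ij: "i < n" "j < n" by simp_all
    show "A $$ (i, j) = 1\<^sub>m n $$ (i, j)"
    proof (cases "i < n - 1 \<or> j < n - 1")
      case True
      then show ?thesis using d ij by simp
    next
      case False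
      then have "i = n - 1" "j = n - 1" using ij by auto
      then show ?thesis using last ij by simp
    qed
  qed (use cA in auto)
qed

text \<open>The right factor adds to column \<open>c\<close> a vector times \<open>- t c\<close>,
  which is zero, so only the left factor is seen there.\<close>

lemma conj_transv_col:
  assumes "A \<in> carrier_mat n n" "c < n" "t c = 0" "i < n"
  shows "(transv n a t * A * transv n a (\<lambda>k. - t k)) $$ (i, c) =
    A $$ (i, c) + a i * (\<Sum>k<n. t k * A $$ (k, c))"
proof -
  have "transv n a t * A \<in> carrier_mat n n" using assms(1) by (rule mult_carrier_mat[OF transv_carrier])
  from mult_transv_index[OF this assms(4,2)] show ?thesis
    unfolding transv_mult_index[OF assms(1,4,2)] by (simp only: assms(3)) simp
qed

section \<open>Matrices that are scalar modulo an element\<close>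

definition mat_cong :: "nat \<Rightarrow> 'a \<Rightarrow> 'a mat \<Rightarrow> 'a :: comm_ring_1 mat \<Rightarrow> bool" where
  "mat_cong n p A B \<longleftrightarrow> (\<forall>i<n. \<forall>j<n. p dvd A $$ (i, j) - B $$ (i, j))"

lemma mat_cong_refl: "mat_cong n p A A"
  by (simp add: mat_cong_def)

lemma mat_cong_sym: "mat_cong n p A B \<Longrightarrow> mat_cong n p B A"
  unfolding mat_cong_def by (subst minus_diff_eq[symmetric], subst dvd_minus_iff)

lemma mat_cong_trans:
  assumes "mat_cong n p A B" "mat_cong n p B C"
  shows "mat_cong n p A C"
  unfolding mat_cong_def
proof (intro allI impI)
  fix i j assume "i < n" "j < n"
  then have "p dvd (A $$ (i, j) - B $$ (i, j)) + (B $$ (i, j) - C $$ (i, j))"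
    using assms unfolding mat_cong_def by (intro dvd_add) auto
  then show "p dvd A $$ (i, j) - C $$ (i, j)" by simp
qed

lemma mat_cong_mult_left:
  assumes c: "A \<in> carrier_mat n n" "B \<in> carrier_mat n n" "C \<in> carrier_mat n n" and AB: "mat_cong n p A B"
  shows "mat_cong n p (C * A) (C * B)"
  unfolding mat_cong_def
proof (intro allI impI)
  fix i j assume ij: "i < n" "j < n"
  have "(C * A) $$ (i, j) - (C * B) $$ (i, j) = (\<Sum>k<n. C $$ (i, k) * (A $$ (k, j) - B $$ (k, j)))"
    unfolding index_mult_mat_sum[OF c(3,1) ij] index_mult_mat_sum[OF c(3,2) ij]
    by (simp add: sum_subtractf right_diff_distrib)
  also have "p dvd \<dots>"
    by (rule dvd_sum) (use AB ij in \<open>auto simp: mat_cong_def\<close>)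
  finally show "p dvd (C * A) $$ (i, j) - (C * B) $$ (i, j)" .
qed

lemma mat_cong_mult_right:
  assumes c: "A \<in> carrier_mat n n" "B \<in> carrier_mat n n" "C \<in> carrier_mat n n" and AB: "mat_cong n p A B"
  shows "mat_cong n p (A * C) (B * C)"
  unfolding mat_cong_def
proof (intro allI impI)
  fix i j assume ij: "i < n" "j < n"
  have "(A * C) $$ (i, j) - (B * C) $$ (i, j) = (\<Sum>k<n. (A $$ (i, k) - B $$ (i, k)) * C $$ (k, j))"
    unfolding index_mult_mat_sum[OF c(1,3) ij] index_mult_mat_sum[OF c(2,3) ij]
    by (simp add: sum_subtractf left_diff_distrib)
  also have "p dvd \<dots>"
    by (rule dvd_sum) (use AB ij in \<open>auto simp: mat_cong_def\<close>)
  finally show "p dvd (A * C) $$ (i, j) - (B * C) $$ (i, j)" .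
qed

text \<open>This is the preimage of the scalar matrices modulo \<open>p\<close>. Describing it by
  commutation with all matrices avoids the quotient ring and makes normality a formal
  computation.\<close>

definition central_mod :: "nat \<Rightarrow> 'a \<Rightarrow> 'a :: comm_ring_1 mat set" where
  "central_mod n p =
     {A \<in> carrier (SL n). \<forall>B\<in>carrier_mat n n. mat_cong n p (A * B) (B * A)}"

lemma central_mod_normal: "central_mod n p \<lhd> SL n"
proof -
  interpret group "SL n :: 'a mat monoid" by (rule group_SL)
  note assoc = assoc_mult_mat[of _ n n _ n _ n] mult_carrier_mat[of _ n n _ n]
  have inv: "inv\<^bsub>SL n\<^esub> A \<in> carrier_mat n n" "A * inv\<^bsub>SL n\<^esub> A = 1\<^sub>m n" "inv\<^bsub>SL n\<^esub> A * A = 1\<^sub>m n"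
    if "A \<in> carrier (SL n)" for A :: "'a mat"
    using inv_closed[OF that] r_inv[OF that] l_inv[OF that] by (simp_all add: mem_SL)
  have "subgroup (central_mod n p) (SL n)"
  proof (rule subgroupI)
    show "central_mod n p \<subseteq> carrier (SL n)" by (auto simp: central_mod_def)
    have "1\<^sub>m n \<in> central_mod n p"
      using one_closed by (auto simp: central_mod_def mat_cong_refl)
    then show "central_mod n p \<noteq> {}" by blast
  next
    fix A assume "A \<in> central_mod n p"
    then have A: "A \<in> carrier (SL n)" and cen: "\<And>B. B \<in> carrier_mat n n \<Longrightarrow> mat_cong n p (A * B) (B * A)"
      by (auto simp: central_mod_def)
    have cA: "A \<in> carrier_mat n n" using A by (simp add: mem_SL)
    define h where "h = inv\<^bsub>SL n\<^esub> A"
    note h = inv[OF A, folded h_def]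
    have "mat_cong n p (h * B) (B * h)" if B: "B \<in> carrier_mat n n" for B
    proof -
      \<comment> \<open>The congruence for \<open>A\<close> is multiplied by the inverse
        \<open>h\<close> on both sides.\<close>
      have "mat_cong n p (h * (B * A) * h) (h * (A * B) * h)"
        by (intro mat_cong_mult_left mat_cong_mult_right mat_cong_sym[OF cen] mult_carrier_mat[of _ n n _ n] B cA h)
      moreover have "h * (B * A) * h = h * B * (A * h)" "h * (A * B) * h = (h * A) * (B * h)"
        using B cA h(1) by (simp_all add: assoc del: index_mult_mat)
      ultimately show ?thesis using h B by simp
    qed
    then show "inv\<^bsub>SL n\<^esub> A \<in> central_mod n p"
      using inv_closed[OF A] unfolding central_mod_def h_def by simp
  next
    fix A A' assume "A \<in> central_mod n p" "A' \<in> central_mod n p"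
    then have A: "A \<in> carrier (SL n)" and cen: "\<And>B. B \<in> carrier_mat n n \<Longrightarrow> mat_cong n p (A * B) (B * A)"
      and A': "A' \<in> carrier (SL n)" and cen': "\<And>B. B \<in> carrier_mat n n \<Longrightarrow> mat_cong n p (A' * B) (B * A')"
      by (auto simp: central_mod_def)
    have cA: "A \<in> carrier_mat n n" "A' \<in> carrier_mat n n" using A A' by (simp_all add: mem_SL)
    have "mat_cong n p (A * A' * B) (B * (A * A'))" if B: "B \<in> carrier_mat n n" for B
    proof -
      have "mat_cong n p (A * (A' * B)) (A * (B * A'))"
        by (intro mat_cong_mult_left cen' mult_carrier_mat[of _ n n _ n] B cA)
      moreover have "mat_cong n p ((A * B) * A') ((B * A) * A')"
        by (intro mat_cong_mult_right cen mult_carrier_mat[of _ n n _ n] B cA)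
      moreover have "A * (A' * B) = A * A' * B" "(A * B) * A' = A * (B * A')" "(B * A) * A' = B * (A * A')"
        using B cA by (simp_all add: assoc)
      ultimately show ?thesis by (metis mat_cong_trans)
    qed
    then show "A \<otimes>\<^bsub>SL n\<^esub> A' \<in> central_mod n p"
      using m_closed[OF A A'] by (simp add: central_mod_def)
  qed
  then show ?thesis
  proof (rule normal_invI)
    fix g A :: "'a mat" assume g: "g \<in> carrier (SL n)" and "A \<in> central_mod n p"
    then have A: "A \<in> carrier (SL n)" and cen: "\<And>B. B \<in> carrier_mat n n \<Longrightarrow> mat_cong n p (A * B) (B * A)"
      by (auto simp: central_mod_def)
    define h where "h = inv\<^bsub>SL n\<^esub> g"
    note h = inv[OF g, folded h_def]
    have c: "A \<in> carrier_mat n n" "g \<in> carrier_mat n n" using A g by (simp_all add: mem_SL)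
    have "mat_cong n p (g * A * h * B) (B * (g * A * h))" if B: "B \<in> carrier_mat n n" for B
    proof -
      \<comment> \<open>\<open>A\<close> is tested against the conjugate \<open>h * B * g\<close>,
        and the result is conjugated back by \<open>g\<close>.\<close>
      have "mat_cong n p (g * (A * (h * B * g)) * h) (g * ((h * B * g) * A) * h)"
        by (intro mat_cong_mult_left mat_cong_mult_right cen mult_carrier_mat[of _ n n _ n] B c h)
      moreover have "g * (A * (h * B * g)) * h = (g * A * h * B) * (g * h)"
        "g * ((h * B * g) * A) * h = (g * h) * (B * (g * A * h))"
        using B c h(1) by (simp_all add: assoc)
      moreover have "g * A * h * B * 1\<^sub>m n = g * A * h * B" "1\<^sub>m n * (B * (g * A * h)) = B * (g * A * h)"
        by (intro right_mult_one_mat[of _ n n] left_mult_one_mat[of _ n n] mult_carrier_mat[of _ n n _ n] B c h)+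
      ultimately show ?thesis unfolding h(2) by metis
    qed
    moreover have "g \<otimes>\<^bsub>SL n\<^esub> A \<otimes>\<^bsub>SL n\<^esub> inv\<^bsub>SL n\<^esub> g \<in> carrier (SL n)"
      using A g by (intro m_closed inv_closed)
    ultimately show "g \<otimes>\<^bsub>SL n\<^esub> A \<otimes>\<^bsub>SL n\<^esub> inv\<^bsub>SL n\<^esub> g \<in> central_mod n p"
      unfolding central_mod_def h_def by simp
  qed
qed

text \<open>Modulo \<open>p\<close> the matrix equals a scalar matrix \<open>D\<close>, which
  commutes exactly with every \<open>B\<close>.\<close>

lemma scalar_mod_central:
  assumes A: "A \<in> carrier (SL n)"
    and off: "\<And>i j. i < n \<Longrightarrow> j < n \<Longrightarrow> i \<noteq> j \<Longrightarrow> p dvd A $$ (i, j)"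
    and diag: "\<And>i. i < n \<Longrightarrow> p dvd A $$ (0, 0) - A $$ (i, i)"
  shows "A \<in> central_mod n p"
proof -
  have cA: "A \<in> carrier_mat n n" using A by (simp add: mem_SL)
  have "mat_cong n p (A * B) (B * A)" if B: "B \<in> carrier_mat n n" for B
  proof -
    define D where "D = A $$ (0, 0) \<cdot>\<^sub>m 1\<^sub>m n"
    have D: "D \<in> carrier_mat n n" by (simp add: D_def)
    have "p dvd A $$ (i, j) - D $$ (i, j)" if "i < n" "j < n" for i j
      using off[OF that] diag[OF that(1)] that dvd_minus_iff[of p "A $$ (0, 0) - A $$ (i, i)"]
      by (cases "i = j") (simp_all add: D_def)
    then have AD: "mat_cong n p A D" by (simp add: mat_cong_def)
    have "D * B = B * D"
      using B mult_smult_assoc_mat[of "1\<^sub>m n" n n B n] mult_smult_distrib[of B n n "1\<^sub>m n" n]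
      by (simp add: D_def)
    then show ?thesis
      using mat_cong_mult_right[OF cA D B AD] mat_cong_sym[OF mat_cong_mult_left[OF cA D B AD]]
      by (metis mat_cong_trans)
  qed
  then show ?thesis using A by (simp add: central_mod_def)
qed

text \<open>The two products with the transposed elementary matrix have \<open>(0, 0)\<close>
  entries \<open>1 + 1\<close> and \<open>1\<close>, whose difference is a unit. So
  \<open>central_mod n p\<close> is a proper subgroup.\<close>

lemma elementary_not_central:
  assumes "2 \<le> n" and "\<not> p dvd 1"
  shows "elementary n 0 1 1 \<notin> central_mod n p"
proof
  assume "elementary n 0 1 1 \<in> central_mod n p"
  then have "mat_cong n p (elementary n 0 1 1 * elementary n 1 0 1) (elementary n 1 0 1 * elementary n 0 1 1)"
    by (simp add: central_mod_def elementary_def)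
  then have "p dvd (elementary n 0 1 1 * elementary n 1 0 1) $$ (0, 0) - (elementary n 1 0 1 * elementary n 0 1 1) $$ (0, 0)"
    using assms(1) by (simp add: mat_cong_def del: index_mult_mat)
  moreover have "(elementary n 0 1 1 * elementary n 1 0 1) $$ (0, 0) = 1 + (1 :: 'a)"
    unfolding elementary_def
    by (subst transv_mult_index) (use assms(1) in auto)
  moreover have "(elementary n 1 0 1 * elementary n 0 1 1) $$ (0, 0) = (1 :: 'a)"
    unfolding elementary_def
    by (subst transv_mult_index) (use assms(1) in auto)
  ultimately show False using assms(2) by simp
qed

section \<open>Words in conjugates of a subset of the special linear group\<close>

text \<open>No generation is assumed of \<open>S\<close>: the same length estimates also serve to
  prove that a set of one elementary matrix normally generates.\<close>

locale SL_conj = semilocal_bezout P for P :: "'a :: idom set" +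
  fixes n :: nat and S :: "'a mat set"
  assumes n: "3 \<le> n" and S: "S \<subseteq> carrier (SL n)"
begin

abbreviation cb :: "nat \<Rightarrow> 'a mat set" where
  "cb \<equiv> conj_ball (SL n) S"

sublocale SL: group "SL n :: 'a mat monoid" by (rule group_SL)

lemma cb_SL: "A \<in> cb m \<Longrightarrow> A \<in> carrier (SL n)"
  by (rule subsetD[OF SL.conj_ball_closed[OF S]])

lemma cb_carrier: "A \<in> cb m \<Longrightarrow> A \<in> carrier_mat n n"
  by (drule cb_SL) (simp add: mem_SL)

lemma cb_mono: "A \<in> cb m \<Longrightarrow> m \<le> m' \<Longrightarrow> A \<in> cb m'"
  by (erule subsetD[OF conj_ball_mono, rotated])

lemma cb_one: "1\<^sub>m n \<in> cb m"
  using one_mem_conj_ball[of "SL n" S m] unfolding SL_simps .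

lemma cb_mult: "A \<in> cb a \<Longrightarrow> A' \<in> cb b \<Longrightarrow> A * A' \<in> cb (a + b)"
  using SL.conj_ball_mult[OF S, of A a A' b] unfolding SL_simps .

lemma cb_conj:
  assumes "A \<in> cb m" "g \<in> carrier (SL n)" "h \<in> carrier_mat n n" "g * h = 1\<^sub>m n"
  shows "g * A * h \<in> cb m"
  using SL.conj_ball_conj[OF S assms(1,2)]
  unfolding SL_simps SL_inv_eq[OF assms(2) SL_right_inverse[OF assms(2-4)] assms(4)] .

lemma cb_inv:
  assumes "A \<in> cb m" "h \<in> carrier_mat n n" "A * h = 1\<^sub>m n"
  shows "h \<in> cb m"
  using SL.conj_ball_inv[OF S assms(1)]
  unfolding SL_inv_eq[OF cb_SL[OF assms(1)] SL_right_inverse[OF cb_SL[OF assms(1)] assms(2,3)] assms(3)] .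

section \<open>Conjugating elementary matrices and transvections\<close>

lemma cb_conj_by_transv:
  assumes "A \<in> cb m" "transv n a b \<in> carrier (SL n)" "(\<Sum>k<n. b k * a k) = 0"
  shows "transv n a b * A * transv n a (\<lambda>k. - b k) \<in> cb m"
  using cb_conj[OF assms(1,2) transv_carrier transv_mult_inverse[OF assms(3)]] .

lemma cb_transv_conj:
  assumes "transv n v w \<in> cb m" "transv n a b \<in> carrier (SL n)" "(\<Sum>k<n. b k * a k) = 0"
    and "\<And>i. i < n \<Longrightarrow> v' i = v i + a i * (\<Sum>k<n. b k * v k)"
    and "\<And>j. j < n \<Longrightarrow> w' j = w j - (\<Sum>k<n. w k * a k) * b j"
  shows "transv n v' w' \<in> cb m"
proof -
  have "transv n v' w' = transv n a b * transv n v w * transv n a (\<lambda>k. - b k)"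
    unfolding conj_transv_transv[OF assms(3)] by (rule transv_cong) (use assms(4,5) in auto)
  then show ?thesis using cb_conj_by_transv[OF assms(1-3)] by simp
qed

text \<open>Conjugation by \<open>1 + e_i' e_i^T\<close> turns the column vector
  \<open>r e_i\<close> into \<open>r e_i + r e_i'\<close>, and conjugation by
  \<open>1 - e_i e_i'^T\<close> removes the first summand. This replaces signed permutation
  matrices.\<close>

lemma elementary_cb_row:
  assumes "elementary n i j r \<in> cb m" "i < n" "j < n" "i' < n" "i \<noteq> j" "i' \<noteq> j"
  shows "elementary n i' j r \<in> cb m"
proof (cases "i = i'")
  case False
  have "transv n (\<lambda>k. r * std i k + r * std i' k) (std j) \<in> cb m"
    by (rule cb_transv_conj[OF assms(1)[unfolded elementary_eq_transv_col], of "std i'" "std i"])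
      (use assms False in \<open>auto intro!: transv_row_SL\<close>)
  then have "transv n (\<lambda>k. r * std i' k) (std j) \<in> cb m"
    by (rule cb_transv_conj[of _ _ _ "std i" "\<lambda>k. - std i' k"])
      (use assms False in \<open>auto intro!: transv_row_SL simp: sum_negf\<close>)
  then show ?thesis by (simp add: elementary_eq_transv_col)
qed (use assms in simp)

lemma elementary_cb_col:
  assumes "elementary n i j r \<in> cb m" "i < n" "j < n" "j' < n" "i \<noteq> j" "i \<noteq> j'"
  shows "elementary n i j' r \<in> cb m"
proof (cases "j = j'")
  case False
  have "transv n (std i) (\<lambda>k. r * std j k + r * std j' k) \<in> cb m"
    by (rule cb_transv_conj[OF assms(1)[unfolded elementary_def], of "std j" "\<lambda>k. - std j' k"])
      (use assms False in \<open>auto intro!: transv_row_SL simp: sum_negf\<close>)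
  then have "transv n (std i) (\<lambda>k. r * std j' k) \<in> cb m"
    by (rule cb_transv_conj[of _ _ _ "std j'" "std j"])
      (use assms False in \<open>auto intro!: transv_row_SL\<close>)
  then show ?thesis by (simp add: elementary_def)
qed (use assms in simp)

lemma ex_third_index: "\<exists>l<n. l \<noteq> i \<and> l \<noteq> j"
proof -
  have "\<exists>l\<in>{0,1,2::nat}. l \<noteq> i \<and> l \<noteq> j" by auto
  moreover have "l < n" if "l \<in> {0,1,2::nat}" for l using that n by auto
  ultimately show ?thesis by blast
qed

lemma elementary_cb:
  assumes e: "elementary n i j r \<in> cb m" and ij: "i < n" "j < n" "i \<noteq> j"
    and ij': "i' < n" "j' < n" "i' \<noteq> j'"
  shows "elementary n i' j' r \<in> cb m"
proof -
  obtain l where l: "l < n" "l \<noteq> i" "l \<noteq> j" using ex_third_index by blast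
  consider "i' \<noteq> j" | "i' = j" "i \<noteq> j'" | "i' = j" "i = j'" by blast
  then show ?thesis
  proof cases
    case 1
    then have "elementary n i' j r \<in> cb m" using elementary_cb_row[OF e] ij ij' by simp
    then show ?thesis by (rule elementary_cb_col) (use 1 ij ij' in auto)
  next
    case 2
    then have "elementary n i j' r \<in> cb m" using elementary_cb_col[OF e] ij ij' by simp
    then show ?thesis by (rule elementary_cb_row) (use 2 ij ij' in auto)
  next
    \<comment> \<open>When the two indices are exchanged, changing one of them first would make them
      equal, so a third index \<open>l\<close> is interposed.\<close>
    case 3
    have "elementary n l j r \<in> cb m" using elementary_cb_row[OF e] ij l by simp
    then have "elementary n l i r \<in> cb m" by (rule elementary_cb_col) (use ij l in auto)
    then have "elementary n j i r \<in> cb m" by (rule elementary_cb_row) (use ij l in auto)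
    then show ?thesis using 3 by simp
  qed
qed

text \<open>Stable range turns entry \<open>p\<close> into a divisor \<open>x\<close> of all entries
  other than entry \<open>j\<close>: \<open>t\<close> records the additions to entry
  \<open>p\<close>, and \<open>q\<close> the quotients of the others. Both vanish at
  \<open>p\<close>, which puts the transvections formed with \<open>e_p\<close> into the group, and
  at \<open>j\<close>, which keeps entry \<open>j\<close> out of the computation.\<close>

lemma vector_gcd:
  fixes v :: "nat \<Rightarrow> 'a"
  assumes p: "p < n" "p \<noteq> j"
  obtains q t x where "q j = 0" "q p = 0" "t j = 0" "t p = 0"
    "\<forall>k<n. k \<noteq> j \<longrightarrow> k \<noteq> p \<longrightarrow> v k = x * q k" "x = v p + (\<Sum>k<n. t k * v k)" "x dvd v p"
proof -
  let ?I = "{..<n} - {j, p}"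
  obtain t where t: "v p + (\<Sum>i\<in>?I. t i * v i) dvd v p"
    "\<forall>i\<in>?I. v p + (\<Sum>i\<in>?I. t i * v i) dvd v i"
    using stable_range_finite[of ?I "v p" v] by auto
  define x where "x = v p + (\<Sum>i\<in>?I. t i * v i)"
  have "\<forall>i\<in>?I. \<exists>q. v i = x * q" using t(2) unfolding x_def[symmetric] dvd_def .
  then obtain q where q: "\<forall>i\<in>?I. v i = x * q i" by metis
  define t' where "t' k = (if k \<in> ?I then t k else 0)" for k
  define q' where "q' k = (if k \<in> ?I then q k else 0)" for k
  have "(\<Sum>k<n. t' k * v k) = (\<Sum>i\<in>?I. t i * v i)"
    by (rule sum.mono_neutral_cong_right) (auto simp: t'_def)
  then have "x = v p + (\<Sum>k<n. t' k * v k)" by (simp add: x_def)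
  moreover have "x dvd v p" using t(1) unfolding x_def .
  moreover have "\<forall>k<n. k \<noteq> j \<longrightarrow> k \<noteq> p \<longrightarrow> v k = x * q' k"
    using q by (simp add: q'_def)
  ultimately show ?thesis
    using that[of q' t' x] by (auto simp: q'_def t'_def)
qed

lemma ex_other_index: "\<exists>p<n. p \<noteq> j"
proof (cases "j = 0")
  case True
  then show ?thesis using n by (intro exI[of _ 1]) auto
next
  case False
  then show ?thesis using n by (intro exI[of _ 0]) auto
qed

text \<open>\<open>E_pj(x)\<close> is conjugated by \<open>1 + q e_p^T\<close>, giving the column
  vector \<open>x e_p + x q\<close>, and then by \<open>1 - e_p t^T\<close>, which turns entry
  \<open>p\<close> from \<open>x\<close> back into \<open>v p\<close>. Hence a whole column costs no
  more than one elementary matrix.\<close>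

lemma transv_col_cb:
  assumes E: "\<And>i j r. i < n \<Longrightarrow> j < n \<Longrightarrow> i \<noteq> j \<Longrightarrow> elementary n i j r \<in> cb K"
    and j: "j < n" "v j = 0"
  shows "transv n v (std j) \<in> cb K"
proof -
  obtain p where p: "p < n" "p \<noteq> j" using ex_other_index by blast
  obtain q t x where qt: "q j = 0" "q p = 0" "t j = 0" "t p = 0"
    and q: "\<forall>k<n. k \<noteq> j \<longrightarrow> k \<noteq> p \<longrightarrow> v k = x * q k"
    and x: "x = v p + (\<Sum>k<n. t k * v k)" and "x dvd v p"
    using vector_gcd[OF p, of v] .
  have "elementary n p j x \<in> cb K" by (rule E) (use p j in auto)
  then have "transv n (\<lambda>k. x * std p k) (std j) \<in> cb K"
    by (simp add: elementary_eq_transv_col)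
  then have "transv n (\<lambda>k. x * std p k + x * q k) (std j) \<in> cb K"
    by (rule cb_transv_conj[of _ _ _ q "std p"])
      (use p j qt in \<open>auto intro!: transv_col_SL\<close>)
  then show ?thesis
  proof (rule cb_transv_conj[of _ _ _ "std p" "\<lambda>k. - t k"])
    have "(\<Sum>k<n. t k * (x * std p k + x * q k)) = (\<Sum>k<n. t k * v k)"
      by (rule sum.cong) (use q qt in \<open>auto simp: std_def\<close>)
    then show "v i = x * std p i + x * q i + std p i * (\<Sum>k<n. - t k * (x * std p k + x * q k))"
      if "i < n" for i
      using that q[rule_format, of i] p j qt x by (cases "i = p"; cases "i = j") (auto simp: sum_negf)
  qed (use p j qt in \<open>auto intro!: transv_row_SL simp: sum_negf\<close>)
qed

text \<open>The transposed argument, with conjugating matrices \<open>1 - e_p q^T\<close> and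
  \<open>1 + t e_p^T\<close>.\<close>

lemma transv_row_cb:
  assumes E: "\<And>i j r. i < n \<Longrightarrow> j < n \<Longrightarrow> i \<noteq> j \<Longrightarrow> elementary n i j r \<in> cb K"
    and j: "j < n" "v j = 0"
  shows "transv n (std j) v \<in> cb K"
proof -
  obtain p where p: "p < n" "p \<noteq> j" using ex_other_index by blast
  obtain q t x where qt: "q j = 0" "q p = 0" "t j = 0" "t p = 0"
    and q: "\<forall>k<n. k \<noteq> j \<longrightarrow> k \<noteq> p \<longrightarrow> v k = x * q k"
    and x: "x = v p + (\<Sum>k<n. t k * v k)" and "x dvd v p"
    using vector_gcd[OF p, of v] .
  have "elementary n j p x \<in> cb K" by (rule E) (use p j in auto)
  then have "transv n (std j) (\<lambda>k. x * std p k) \<in> cb K"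
    by (simp add: elementary_def)
  then have "transv n (std j) (\<lambda>k. x * std p k + x * q k) \<in> cb K"
    by (rule cb_transv_conj[of _ _ _ "std p" "\<lambda>k. - q k"])
      (use p j qt in \<open>auto intro!: transv_row_SL simp: sum_negf\<close>)
  then show ?thesis
  proof (rule cb_transv_conj[of _ _ _ t "std p"])
    have "(\<Sum>k<n. (x * std p k + x * q k) * t k) = (\<Sum>k<n. t k * v k)"
      by (rule sum.cong) (use q qt in \<open>auto simp: std_def\<close>)
    then show "v i = x * std p i + x * q i - (\<Sum>k<n. (x * std p k + x * q k) * t k) * std p i"
      if "i < n" for i
      using that q[rule_format, of i] p j qt x by (cases "i = p"; cases "i = j") auto
  qed (use p j qt in \<open>auto intro!: transv_col_SL\<close>)
qed

section \<open>Reducing a matrix to the identity\<close>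

lemma SL_mult: "A \<in> carrier (SL n) \<Longrightarrow> B \<in> carrier (SL n) \<Longrightarrow> A * B \<in> carrier (SL n :: 'a mat monoid)"
  using SL.m_closed[of A B] unfolding SL_simps .

lemma cb_conjD:
  assumes g: "g \<in> carrier (SL n)" and h: "h \<in> carrier_mat n n" and gh: "g * h = 1\<^sub>m n"
    and A: "A \<in> carrier_mat n n" and "g * A * h \<in> cb m"
  shows "A \<in> cb m"
proof -
  have g': "g \<in> carrier_mat n n" using g by (simp add: mem_SL)
  have hg: "h * g = 1\<^sub>m n"
    using SL.l_inv[OF g] unfolding SL_simps SL_inv_eq[OF g SL_right_inverse[OF g h gh] gh] .
  have "h * (g * A * h) * g \<in> cb m"
    by (rule cb_conj[OF assms(5) SL_right_inverse[OF g h gh] g' hg])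
  moreover have "h * (g * A * h) * g = (h * g) * A * (h * g)"
    using g' h A by (simp add: assoc_mult_mat[of _ n n _ n _ n] mult_carrier_mat[of _ n n _ n])
  ultimately show ?thesis using A by (simp add: hg)
qed

text \<open>The reduction is read backwards: a bound for the simplified matrix gives one for
  \<open>A\<close> at the additional cost of \<open>g\<close>.\<close>

lemma cb_leftD:
  assumes g: "g \<in> cb a" and A: "A \<in> carrier_mat n n" and "g * A \<in> cb b"
  shows "A \<in> cb (b + a)"
proof -
  obtain h where h: "h \<in> carrier (SL n)" "g * h = 1\<^sub>m n" "h * g = 1\<^sub>m n"
    using SL_inverseE[OF cb_SL[OF g]] .
  have hc: "h \<in> carrier_mat n n" using h by (simp add: mem_SL)
  have "h * (g * A) \<in> cb (a + b)"
    by (rule cb_mult[OF cb_inv[OF g hc h(2)] assms(3)])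
  moreover have "h * (g * A) = A"
    using assoc_mult_mat[OF hc cb_carrier[OF g] A] h A by simp
  ultimately show ?thesis by (simp add: add.commute)
qed

lemma cb_rightD:
  assumes g: "g \<in> cb a" and A: "A \<in> carrier_mat n n" and "A * g \<in> cb b"
  shows "A \<in> cb (b + a)"
proof -
  obtain h where h: "h \<in> carrier (SL n)" "g * h = 1\<^sub>m n" "h * g = 1\<^sub>m n"
    using SL_inverseE[OF cb_SL[OF g]] .
  have hc: "h \<in> carrier_mat n n" using h by (simp add: mem_SL)
  have "A * g * h \<in> cb (b + a)"
    by (rule cb_mult[OF assms(3) cb_inv[OF g hc h(2)]])
  moreover have "A * g * h = A"
    using assoc_mult_mat[OF A cb_carrier[OF g] hc] h A by simp
  ultimately show ?thesis by simp
qed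

text \<open>Row \<open>m\<close> of the inverse times column \<open>m\<close> is \<open>1\<close>,
  and the entries of that column above row \<open>m\<close> vanish.\<close>

lemma clean_column_unit:
  assumes A: "A \<in> carrier (SL n)" and c: "clean n m A" and m: "m < n"
    and x: "\<And>k. m \<le> k \<Longrightarrow> k < n \<Longrightarrow> x dvd A $$ (k, m)"
  shows "x dvd 1"
proof -
  obtain B where B: "B \<in> carrier (SL n)" "B * A = 1\<^sub>m n"
    using SL_inverseE[OF A] by metis
  have "(\<Sum>k<n. B $$ (m, k) * A $$ (k, m)) = (B * A) $$ (m, m)"
    by (rule index_mult_mat_sum[symmetric]) (use A B(1) m in \<open>auto simp: mem_SL\<close>)
  also have "\<dots> = 1" using B(2) m by simp
  finally have "(\<Sum>k<n. B $$ (m, k) * A $$ (k, m)) = 1" .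
  moreover have "x dvd (\<Sum>k<n. B $$ (m, k) * A $$ (k, m))"
  proof (rule dvd_sum)
    fix k assume "k \<in> {..<n}"
    then show "x dvd B $$ (m, k) * A $$ (k, m)"
      using x[of k] cleanD[OF c, of k m] m by (cases "k < m") auto
  qed
  ultimately show ?thesis by simp
qed

text \<open>Row operations that add multiples of lower rows to row \<open>m\<close> do not change column \<open>m\<close> when they
  are undone on the right, so up to conjugation they are free. This is why three transvections
  suffice: two to clear column \<open>m\<close> and one to clear row \<open>m\<close>.\<close>

lemma clean_step:
  assumes E: "\<And>i j r. i < n \<Longrightarrow> j < n \<Longrightarrow> i \<noteq> j \<Longrightarrow> elementary n i j r \<in> cb K"
    and A: "A \<in> carrier (SL n)" and c: "clean n m A" and m: "Suc m < n"
  obtains A' where "A' \<in> carrier (SL n)" "clean n (Suc m) A'" "\<And>b. A' \<in> cb b \<Longrightarrow> A \<in> cb (b + 3 * K)"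
proof -
  have mn: "m < n" using m by simp
  have cA: "A \<in> carrier_mat n n" using A by (simp add: mem_SL)
  let ?I = "{Suc m..<n}"
  obtain t0 where t0: "A $$ (m, m) + (\<Sum>i\<in>?I. t0 i * A $$ (i, m)) dvd A $$ (m, m)"
      "\<forall>i\<in>?I. A $$ (m, m) + (\<Sum>i\<in>?I. t0 i * A $$ (i, m)) dvd A $$ (i, m)"
    using stable_range_finite[of ?I "A $$ (m, m)" "\<lambda>i. A $$ (i, m)"] by auto
  define x where "x = A $$ (m, m) + (\<Sum>i\<in>?I. t0 i * A $$ (i, m))"
  have "x dvd A $$ (k, m)" if "m \<le> k" "k < n" for k
    using t0 that unfolding x_def[symmetric] by (cases "k = m") auto
  then have "x dvd 1" by (rule clean_column_unit[OF A c mn])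
  then obtain y where xy: "1 = x * y" by (elim dvdE)
  define t where "t k = (if k \<in> ?I then t0 k else 0)" for k
  have t: "\<forall>k\<le>m. t k = 0" by (simp add: t_def)
  have "(\<Sum>k<n. t k * A $$ (k, m)) = (\<Sum>i\<in>?I. t0 i * A $$ (i, m))"
    by (rule sum.mono_neutral_cong_right) (auto simp: t_def)
  then have x: "x = A $$ (m, m) + (\<Sum>k<n. t k * A $$ (k, m))" by (simp add: x_def)

  \<comment> \<open>The free moves: conjugation does not change the length.\<close>
  have row_conj: "transv n (std m) s * M * transv n (std m) (\<lambda>k. - s k) \<in> carrier (SL n) \<and>
      clean n m (transv n (std m) s * M * transv n (std m) (\<lambda>k. - s k)) \<and>
      (\<forall>b. transv n (std m) s * M * transv n (std m) (\<lambda>k. - s k) \<in> cb b \<longrightarrow> M \<in> cb b)"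
    if M: "M \<in> carrier (SL n)" "clean n m M" and s: "\<forall>k\<le>m. s k = 0" for M s
  proof (intro conjI allI impI)
    have cM: "M \<in> carrier_mat n n" using M by (simp add: mem_SL)
    have T: "transv n (std m) s \<in> carrier (SL n)" "transv n (std m) (\<lambda>k. - s k) \<in> carrier (SL n)"
      using mn s by (auto intro!: transv_row_SL)
    show "transv n (std m) s * M * transv n (std m) (\<lambda>k. - s k) \<in> carrier (SL n)"
      by (intro SL_mult T M)
    show "clean n m (transv n (std m) s * M * transv n (std m) (\<lambda>k. - s k))"
      by (intro clean_mult clean_transv mult_carrier_mat[of _ n n] transv_carrier cM M)
        (use s in \<open>auto simp: std_def\<close>)
    have "(\<Sum>k<n. s k * std m k) = 0" using mn s by simp
    then have "transv n (std m) s * transv n (std m) (\<lambda>k. - s k) = 1\<^sub>m n"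
      by (rule transv_mult_inverse)
    then show "M \<in> cb b" if "transv n (std m) s * M * transv n (std m) (\<lambda>k. - s k) \<in> cb b" for b
      using cb_conjD[OF T(1) transv_carrier _ cM that] by blast
  qed
  \<comment> \<open>The paid moves: multiplication by one transvection adds
    \<open>K\<close>.\<close>
  have col_mult: "transv n s (std m) * M \<in> carrier (SL n) \<and> clean n m (transv n s (std m) * M) \<and>
      (\<forall>b. transv n s (std m) * M \<in> cb b \<longrightarrow> M \<in> cb (b + K))"
    if M: "M \<in> carrier (SL n)" "clean n m M" and s: "\<forall>k\<le>m. s k = 0" for M s
  proof (intro conjI allI impI)
    have cM: "M \<in> carrier_mat n n" using M by (simp add: mem_SL)
    have T: "transv n s (std m) \<in> carrier (SL n)"
      using mn s by (auto intro!: transv_col_SL)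
    show "transv n s (std m) * M \<in> carrier (SL n)"
      by (intro SL_mult T M)
    show "clean n m (transv n s (std m) * M)"
      by (intro clean_mult clean_transv transv_carrier cM M) (use s in \<open>auto simp: std_def\<close>)
    show "M \<in> cb (b + K)" if "transv n s (std m) * M \<in> cb b" for b
      by (rule cb_leftD[OF transv_col_cb[OF E mn] cM that]) (use s in auto)
  qed

  \<comment> \<open>A free move makes the pivot at \<open>(m, m)\<close> the unit
    \<open>x\<close>.\<close>
  define A1 where "A1 = transv n (std m) t * A * transv n (std m) (\<lambda>k. - t k)"
  have A1: "A1 \<in> carrier (SL n)" "clean n m A1" "\<And>b. A1 \<in> cb b \<Longrightarrow> A \<in> cb b"
    using row_conj[OF A c t] unfolding A1_def[symmetric] by blast+
  have A1m: "A1 $$ (m, m) = x"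
    unfolding A1_def conj_transv_col[where t = t, OF cA mn t[rule_format, OF order_refl] mn] x by simp

  \<comment> \<open>Since \<open>y\<close> inverts the pivot, a paid move can prescribe the column
    below it: zeros, except for a \<open>1\<close> planted in row \<open>Suc m\<close>.\<close>
  define s1 where "s1 k = (if k \<le> m then 0 else (std (Suc m) k - A1 $$ (k, m)) * y)" for k
  define A2 where "A2 = transv n s1 (std m) * A1"
  have "\<forall>k\<le>m. s1 k = 0" by (simp add: s1_def)
  from col_mult[OF A1(1,2) this]
  have A2: "A2 \<in> carrier (SL n)" "clean n m A2" "\<And>b. A2 \<in> cb b \<Longrightarrow> A1 \<in> cb (b + K)"
    unfolding A2_def[symmetric] by blast+
  have A2m: "A2 $$ (k, m) = (if k = m then x else std (Suc m) k)" if k: "m \<le> k" "k < n" for k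
  proof -
    have "A2 $$ (k, m) = A1 $$ (k, m) + s1 k * x"
      unfolding A2_def using transv_mult_index[of A1 n k m s1 "std m"] A1(1) k mn A1m
      by (simp add: mem_SL del: index_mult_mat)
    moreover have "s1 k * x = std (Suc m) k - A1 $$ (k, m)" if "k \<noteq> m"
    proof -
      have "s1 k = (std (Suc m) k - A1 $$ (k, m)) * y" using k that by (simp add: s1_def)
      then show ?thesis by (simp only: mult.assoc mult.commute[of y x] xy[symmetric] mult_1_right)
    qed
    moreover have "s1 m = 0" by (simp add: s1_def)
    ultimately show ?thesis using A1m by (cases "k = m") simp_all
  qed

  \<comment> \<open>A free move adds \<open>1 - x\<close> times row \<open>Suc m\<close> to row
    \<open>m\<close>; the planted \<open>1\<close> thereby turns the pivot \<open>x\<close> into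
    \<open>1\<close>.\<close>
  define s2 where "s2 k = (1 - x) * std (Suc m) k" for k
  define A3 where "A3 = transv n (std m) s2 * A2 * transv n (std m) (\<lambda>k. - s2 k)"
  have s2: "\<forall>k\<le>m. s2 k = 0" by (simp add: s2_def)
  have A3: "A3 \<in> carrier (SL n)" "clean n m A3" "\<And>b. A3 \<in> cb b \<Longrightarrow> A2 \<in> cb b"
    using row_conj[OF A2(1,2) s2] unfolding A3_def[symmetric] by blast+
  have A3m: "A3 $$ (k, m) = (if k = m then 1 else std (Suc m) k)" if k: "m \<le> k" "k < n" for k
  proof -
    have cA2: "A2 \<in> carrier_mat n n" using A2(1) by (simp add: mem_SL)
    have "(\<Sum>k<n. s2 k * A2 $$ (k, m)) = (1 - x) * A2 $$ (Suc m, m)"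
      using m by (simp add: s2_def mult.assoc sum_distrib_left[symmetric])
    also have "\<dots> = 1 - x" using A2m[of "Suc m"] m by simp
    finally have "A3 $$ (k, m) = A2 $$ (k, m) + std m k * (1 - x)"
      unfolding A3_def conj_transv_col[where t = s2, OF cA2 mn s2[rule_format, OF order_refl] k(2)] by simp
    then show ?thesis using A2m[OF k] by simp
  qed

  \<comment> \<open>The second paid move removes the planted \<open>1\<close>.\<close>
  define s3 :: "nat \<Rightarrow> 'a" where "s3 k = - std (Suc m) k" for k
  define A4 where "A4 = transv n s3 (std m) * A3"
  have "\<forall>k\<le>m. s3 k = 0" by (simp add: s3_def)
  from col_mult[OF A3(1,2) this]
  have A4: "A4 \<in> carrier (SL n)" "clean n m A4" "\<And>b. A4 \<in> cb b \<Longrightarrow> A3 \<in> cb (b + K)"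
    unfolding A4_def[symmetric] by blast+
  have A4m: "A4 $$ (k, m) = std m k" if k: "k < n" for k
  proof (cases "m \<le> k")
    case True
    have "A4 $$ (k, m) = A3 $$ (k, m) + s3 k * A3 $$ (m, m)"
      unfolding A4_def using transv_mult_index[of A3 n k m s3 "std m"] A3(1) k mn
      by (simp add: mem_SL del: index_mult_mat)
    then show ?thesis using A3m[OF True k] A3m[OF order_refl mn] by (auto simp: s3_def)
  next
    case False
    then show ?thesis using cleanD[OF A4(2) k mn] by (simp add: std_def)
  qed

  \<comment> \<open>Column \<open>m\<close> is now \<open>e_m\<close>, so the factor
    \<open>1 + e_m w^T\<close> on the right changes row \<open>m\<close> only and clears it; this is
    the third paid move.\<close>
  define w where "w k = (if k \<le> m then 0 else - A4 $$ (m, k))" for k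
  define A5 where "A5 = A4 * transv n (std m) w"
  have cA4: "A4 \<in> carrier_mat n n" using A4(1) by (simp add: mem_SL)
  have wm: "w m = 0" by (simp add: w_def)
  have A5: "A5 \<in> carrier (SL n)"
    unfolding A5_def by (intro SL_mult A4 transv_row_SL mn wm)
  have A5i: "A5 $$ (i, j) = A4 $$ (i, j) + std m i * w j" if "i < n" "j < n" for i j
    unfolding A5_def using mult_transv_index[OF cA4 that] A4m[OF that(1)] mn by simp
  have "clean n (Suc m) A5"
    unfolding clean_def
  proof (intro allI impI)
    fix i j assume ij: "i < n" "j < n" "i < Suc m \<or> j < Suc m"
    consider "i < m \<or> j < m" | "i = m" "m < j" | "j = m" "m \<le> i" using ij by linarith
    then show "A5 $$ (i, j) = (if i = j then 1 else 0)"
    proof cases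
      case 1
      then have "std m i * w j = 0" by (auto simp: w_def)
      then show ?thesis using A5i[OF ij(1,2)] cleanD[OF A4(2) ij(1,2) 1] by simp
    next
      case 2
      then show ?thesis using A5i[OF ij(1,2)] by (simp add: w_def)
    next
      case 3
      then show ?thesis using A5i[OF ij(1,2)] A4m[OF ij(1)] wm by (simp add: std_def)
    qed
  qed
  moreover have "A \<in> cb (b + 3 * K)" if "A5 \<in> cb b" for b
  proof -
    have "A4 \<in> cb (b + K)"
      by (rule cb_rightD[OF transv_row_cb[where v = w, OF E mn wm] cA4]) (use that A5_def in auto)
    then have "A \<in> cb (b + K + K + K)"
      by (intro A1(3) A2(3) A3(3) A4(3))
    moreover have "b + K + K + K = b + 3 * K" by simp
    ultimately show ?thesis by (simp only:)
  qed
  ultimately show ?thesis using that A5 by blast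
qed

text \<open>Each of the first \<open>n - 1\<close> diagonal positions costs \<open>3 * K\<close>;
  the last one is free because the determinant fixes it.\<close>

lemma SL_subset_cb:
  assumes E: "\<And>i j r. i < n \<Longrightarrow> j < n \<Longrightarrow> i \<noteq> j \<Longrightarrow> elementary n i j r \<in> cb K"
  shows "carrier (SL n) \<subseteq> cb (3 * K * (n - 1))"
proof -
  have "A \<in> cb (3 * K * (n - 1 - m))" if "A \<in> carrier (SL n)" "clean n m A" "m \<le> n - 1" for A m
    using that
  proof (induction "n - 1 - m" arbitrary: A m)
    case 0
    then have "m = n - 1" by simp
    then have "A = 1\<^sub>m n" using clean_SL_eq_one[of A n] 0 n by simp
    then show ?case using cb_one by simp
  next
    case (Suc l)
    have m: "Suc m < n" using Suc.hyps(2) by simp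
    obtain A' where A': "A' \<in> carrier (SL n)" "clean n (Suc m) A'"
      "\<And>b. A' \<in> cb b \<Longrightarrow> A \<in> cb (b + 3 * K)"
      using clean_step[OF E Suc.prems(1,2) m] by blast
    have "A' \<in> cb (3 * K * (n - 1 - Suc m))"
      by (rule Suc.hyps(1)) (use Suc.hyps(2) A' m in auto)
    then have "A \<in> cb (3 * K * (n - 1 - Suc m) + 3 * K)" by (rule A'(3))
    moreover have "n - 1 - m = Suc (n - 1 - Suc m)" using m by simp
    then have "3 * K * (n - 1 - Suc m) + 3 * K = 3 * K * (n - 1 - m)"
      by (simp only: mult_Suc_right add.commute)
    ultimately show ?case by simp
  qed
  from this[of _ 0] show ?thesis by (auto simp: clean_def)
qed

section \<open>Elementary matrices from four conjugates\<close>

definition level :: "'a set" where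
  "level = {x. \<forall>i<n. \<forall>j<n. \<forall>r. i \<noteq> j \<longrightarrow> elementary n i j (x * r) \<in> cb 4}"

text \<open>One position is enough, since elementary matrices with the same entry in different
  positions are conjugate.\<close>

lemma levelI:
  assumes "\<And>r. elementary n i j (x * r) \<in> cb 4" "i < n" "j < n" "i \<noteq> j"
  shows "x \<in> level"
  unfolding level_def using elementary_cb[OF assms(1) assms(2-4)] by blast

lemma levelD:
  "x \<in> level \<Longrightarrow> i < n \<Longrightarrow> j < n \<Longrightarrow> i \<noteq> j \<Longrightarrow> elementary n i j (x * r) \<in> cb 4"
  unfolding level_def by blast

text \<open>Bracketed as \<open>A * (g * B * h)\<close>, the commutator is \<open>A\<close> times a
  conjugate of its inverse, so \<open>g\<close> itself costs nothing.\<close>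

lemma cb_commutator:
  assumes A: "A \<in> cb m" and g: "g \<in> carrier (SL n)"
    and B: "B \<in> carrier_mat n n" "A * B = 1\<^sub>m n" and h: "h \<in> carrier_mat n n" "g * h = 1\<^sub>m n"
  shows "A * g * B * h \<in> cb (m + m)"
proof -
  have "A * (g * B * h) \<in> cb (m + m)"
    by (rule cb_mult[OF A cb_conj[OF cb_inv[OF A B] g h]])
  moreover have "A * (g * B * h) = A * g * B * h"
  proof -
    have "A \<in> carrier_mat n n" "g \<in> carrier_mat n n" using cb_carrier[OF A] g by (simp_all add: mem_SL)
    then show ?thesis using B h
      by (simp add: assoc_mult_mat[of _ n n _ n _ n] mult_carrier_mat[of _ n n _ n])
  qed
  ultimately show ?thesis by simp
qed

text \<open>For \<open>A\<close> with \<open>A e\<^sub>c = a e\<^sub>c + x e\<^sub>p\<close>, the commutator \<open>D = [A, 1 + e\<^sub>c w\<^sup>T]\<close> with \<open>w\<close> a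
  multiple of row \<open>l\<close> of \<open>A\<close> fixes \<open>e\<^sub>c\<close>, and its rows \<open>p\<close> and \<open>l\<close> are
  \<open>e\<^sub>p + r x e\<^sub>l\<close> and \<open>e\<^sub>l\<close>; hence \<open>[D, E\<^sub>c\<^sub>p(-1)]\<close> is elementary.\<close>

lemma double_commutator:
  assumes A: "A \<in> cb 1" and c: "c < n" and p: "p < n" "p \<noteq> c"
    and zero: "\<And>i. i < n \<Longrightarrow> i \<noteq> c \<Longrightarrow> i \<noteq> p \<Longrightarrow> A $$ (i, c) = 0"
  shows "A $$ (p, c) \<in> level"
proof -
  define x where "x = A $$ (p, c)"
  obtain l where l: "l < n" "l \<noteq> c" "l \<noteq> p" using ex_third_index by blast
  have cA: "A \<in> carrier_mat n n" using cb_carrier[OF A] .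
  obtain B where B: "B \<in> carrier (SL n)" "A * B = 1\<^sub>m n" using SL_inverseE[OF cb_SL[OF A]] .
  have cB: "B \<in> carrier_mat n n" using B by (simp add: mem_SL)
  have "elementary n c l (x * r) \<in> cb 4" for r
  proof -
    \<comment> \<open>As a multiple of row \<open>l\<close> of \<open>A\<close>, this vector becomes
      \<open>r e_l^T\<close> after multiplication by the inverse of \<open>A\<close>. It vanishes at
      \<open>c\<close> by \<open>zero\<close>, which puts \<open>?T\<close> into the group.\<close>
    define w where "w k = r * A $$ (l, k)" for k
    have wc: "w c = 0" using zero l by (simp add: w_def)
    let ?T = "transv n (std c) w" and ?T' = "transv n (std c) (\<lambda>k. - w k)"
    define D where "D = A * ?T * B * ?T'"
    have D2: "D \<in> cb (1 + 1)"
      unfolding D_def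
      by (rule cb_commutator[OF A transv_row_SL[of c n w] cB B(2) transv_carrier transv_mult_inverse])
        (use c wc in simp_all)
    have cD: "D \<in> carrier_mat n n" using cb_carrier[OF D2] .
    define v where "v i = A $$ (i, c)" for i
    have X: "A * ?T * B = transv n v (\<lambda>k. r * std l k)"
    proof (rule conj_transv[OF cA cB B(2)])
      show "v i = (\<Sum>k<n. A $$ (i, k) * std c k)" for i using c by (simp add: v_def)
      show "w j = (\<Sum>k<n. r * std l k * A $$ (k, j))" for j
        using l by (simp add: w_def mult.assoc sum_distrib_left[symmetric])
    qed
    have D: "D $$ (i, j) = (if i = j then 1 else 0) + v i * (r * std l j) - std c i * w j"
      if ij: "i < n" "j < n" for i j
    proof -
      have "D $$ (i, j) = transv n v (\<lambda>k. r * std l k) $$ (i, j)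
          + (\<Sum>k<n. transv n v (\<lambda>k. r * std l k) $$ (i, k) * std c k) * (- w j)"
        unfolding D_def X by (rule mult_transv_index[OF transv_carrier ij])
      also have "(\<Sum>k<n. transv n v (\<lambda>k. r * std l k) $$ (i, k) * std c k) = std c i"
        unfolding sum_transv_col[OF ij(1)] using c l by (simp add: mult.assoc sum_distrib_left[symmetric])
      finally show ?thesis using ij by simp
    qed
    obtain D' where D': "D' \<in> carrier (SL n)" "D * D' = 1\<^sub>m n" using SL_inverseE[OF cb_SL[OF D2]] .
    have cD': "D' \<in> carrier_mat n n" using D' by (simp add: mem_SL)
    let ?F = "transv n (std c) (\<lambda>k. - std p k)" and ?F' = "transv n (std c) (\<lambda>k. - (- std p k))"
    let ?w = "\<lambda>k. - std p k + (x * r) * std l k"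
    \<comment> \<open>\<open>D\<close> fixes the column vector \<open>e_c\<close> and sends the row
      vector \<open>?w\<close> to \<open>- e_p^T\<close>, which are the two hypotheses of
      \<open>conj_transv\<close>.\<close>
    have Y: "D * ?F * D' = transv n (std c) ?w"
    proof (rule conj_transv[OF cD cD' D'(2)])
      show "std c i = (\<Sum>k<n. D $$ (i, k) * std c k)" if i: "i < n" for i
        unfolding sum_std(2)[OF c] D[OF i c] using l wc by (simp add: std_def)
      show "- std p j = (\<Sum>k<n. ?w k * D $$ (k, j))" if j: "j < n" for j
      proof -
        have "(\<Sum>k<n. ?w k * D $$ (k, j)) = (\<Sum>k<n. std p k * (- D $$ (k, j))) + (\<Sum>k<n. std l k * (x * r * D $$ (k, j)))"
          unfolding sum.distrib[symmetric] by (rule sum.cong) (simp_all add: algebra_simps)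
        also have "\<dots> = - D $$ (p, j) + x * r * D $$ (l, j)"
          by (simp only: sum_std(1)[OF p(1)] sum_std(1)[OF l(1)])
        also have "v p = x" "v l = 0" using zero l by (simp_all add: v_def x_def)
        then have "- D $$ (p, j) + x * r * D $$ (l, j) = - std p j"
          using D[OF p(1) j] D[OF l(1) j] p l by (simp add: std_def)
        finally show ?thesis by simp
      qed
    qed
    have "D * ?F * D' * ?F' \<in> cb ((1 + 1) + (1 + 1))"
      by (rule cb_commutator[OF D2 transv_row_SL cD' D'(2) transv_carrier transv_mult_inverse])
        (use c p in \<open>simp_all add: sum_negf\<close>)
    \<comment> \<open>The last factor adds \<open>e_p\<close> to the row vector and leaves only its
      multiple of \<open>e_l\<close>.\<close>
    moreover have "D * ?F * D' * ?F' = elementary n c l (x * r)"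
    proof -
      have "(\<Sum>k<n. ?w k * std c k) = 0" using c p l by simp
      from transv_mult_same_left[OF this, of "\<lambda>k. - (- std p k)"] show ?thesis
        unfolding Y elementary_def by simp
    qed
    moreover have "(1 + 1) + (1 + 1) = (4 :: nat)" by simp
    ultimately show ?thesis by (simp only:)
  qed
  then show ?thesis using levelI[of c l x] c l by (simp add: x_def)
qed

text \<open>Two conjugations bring \<open>A\<close> into the shape required by
  \<open>double_commutator\<close>: the first adds multiples of other rows to row \<open>p\<close>
  so that its entry in column \<open>c\<close> becomes \<open>x\<close>, the second uses this entry
  to clear the rest of the column off the diagonal.\<close>

lemma column_level:
  assumes A: "A \<in> cb 1" and c: "c < n"
  obtains x where "x \<in> level" "\<And>i. i < n \<Longrightarrow> i \<noteq> c \<Longrightarrow> x dvd A $$ (i, c)"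
proof -
  obtain p where p: "p < n" "p \<noteq> c" using ex_other_index by blast
  define v where "v k = A $$ (k, c)" for k
  obtain q t x where qt: "q c = 0" "q p = 0" "t c = 0" "t p = 0"
    and q: "\<forall>k<n. k \<noteq> c \<longrightarrow> k \<noteq> p \<longrightarrow> v k = x * q k"
    and x: "x = v p + (\<Sum>k<n. t k * v k)" and xp: "x dvd v p"
    using vector_gcd[OF p, of v] .
  define A1 where "A1 = transv n (std p) t * A * transv n (std p) (\<lambda>k. - t k)"
  have A1: "A1 \<in> cb 1"
    unfolding A1_def by (rule cb_conj_by_transv[OF A transv_row_SL]) (use p qt in simp_all)
  have A1c: "A1 $$ (i, c) = v i + std p i * (x - v p)" if "i < n" for i
    unfolding A1_def conj_transv_col[where t = t, OF cb_carrier[OF A] c qt(3) that]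
    unfolding v_def[symmetric] using x by simp
  define A2 where "A2 = transv n q (\<lambda>k. - std p k) * A1 * transv n q (\<lambda>k. - (- std p k))"
  have "transv n (\<lambda>k. - q k) (std p) \<in> carrier (SL n)"
    by (rule transv_col_SL) (use p qt in simp_all)
  then have "transv n q (\<lambda>k. - std p k) \<in> carrier (SL n)"
    unfolding transv_uminus .
  then have A2: "A2 \<in> cb 1"
    unfolding A2_def by (rule cb_conj_by_transv[OF A1]) (use p qt in \<open>simp_all add: sum_negf\<close>)
  have pc: "- std p c = (0 :: 'a)" using p by simp
  have A2c: "A2 $$ (i, c) = v i + std p i * (x - v p) - q i * x" if i: "i < n" for i
  proof -
    have "(\<Sum>k<n. - std p k * A1 $$ (k, c)) = - x" using p A1c[OF p(1)] by (simp add: sum_negf)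
    then show ?thesis
      unfolding A2_def conj_transv_col[where t = "\<lambda>k. - std p k", OF cb_carrier[OF A1] c pc i]
      using A1c[OF i] by simp
  qed
  have "A2 $$ (p, c) \<in> level"
    by (rule double_commutator[OF A2 c p]) (use A2c q in \<open>simp add: mult.commute\<close>)
  then have "x \<in> level" using A2c[OF p(1)] qt by simp
  moreover have "x dvd A $$ (i, c)" if "i < n" "i \<noteq> c" for i
    using that q xp unfolding v_def[symmetric] by (cases "i = p") auto
  ultimately show ?thesis by (rule that)
qed

text \<open>The columns control the off-diagonal entries. For the diagonal, \<open>A\<close> is
  conjugated by \<open>1 + v e_0^T\<close> with \<open>v\<close> equal to \<open>1\<close> away from
  \<open>0\<close>: below the top, column \<open>0\<close> of the result is congruent to
  \<open>A $$ (0, 0) - A $$ (i, i)\<close> modulo the off-diagonal entries of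
  \<open>A\<close>.\<close>

lemma level_separates:
  assumes A: "A \<in> cb 1"
  obtains f where "\<And>c. c \<le> n \<Longrightarrow> f c \<in> level"
    "\<And>p i j. \<forall>c\<le>n. p dvd f c \<Longrightarrow> i < n \<Longrightarrow> j < n \<Longrightarrow> i \<noteq> j \<Longrightarrow> p dvd A $$ (i, j)"
    "\<And>p i. \<forall>c\<le>n. p dvd f c \<Longrightarrow> i < n \<Longrightarrow> p dvd A $$ (0, 0) - A $$ (i, i)"
proof -
  have cA: "A \<in> carrier_mat n n" using cb_carrier[OF A] .
  have n0: "0 < n" using n by simp
  have "\<exists>x. x \<in> level \<and> (\<forall>i<n. i \<noteq> c \<longrightarrow> x dvd A $$ (i, c))" if "c < n" for c
    using column_level[OF A that] by metis
  then obtain g where g: "\<And>c. c < n \<Longrightarrow> g c \<in> level"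
    "\<And>c i. c < n \<Longrightarrow> i < n \<Longrightarrow> i \<noteq> c \<Longrightarrow> g c dvd A $$ (i, c)" by metis
  define v :: "nat \<Rightarrow> 'a" where "v k = (if k = 0 then 0 else 1)" for k
  let ?C = "transv n v (std 0) * A * transv n v (\<lambda>k. - std 0 k)"
  have C: "?C \<in> cb 1"
    by (rule cb_conj_by_transv[OF A transv_col_SL]) (use n0 in \<open>simp_all add: v_def\<close>)
  obtain y where y: "y \<in> level" "\<And>i. i < n \<Longrightarrow> i \<noteq> 0 \<Longrightarrow> y dvd ?C $$ (i, 0)"
    using column_level[OF C n0] by blast
  have C0: "?C $$ (i, 0) = A $$ (i, 0) + v i * A $$ (0, 0)
      - (\<Sum>k<n. A $$ (i, k) * v k) - v i * (\<Sum>k<n. A $$ (0, k) * v k)" if i: "i < n" for i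
  proof -
    have "transv n v (std 0) * A \<in> carrier_mat n n" using cA by (rule mult_carrier_mat[OF transv_carrier])
    from mult_transv_index[OF this i n0]
    have "?C $$ (i, 0) = (transv n v (std 0) * A) $$ (i, 0)
        - (\<Sum>k<n. (transv n v (std 0) * A) $$ (i, k) * v k)" by (simp del: index_mult_mat)
    also have "(\<Sum>k<n. (transv n v (std 0) * A) $$ (i, k) * v k)
        = (\<Sum>k<n. A $$ (i, k) * v k + v i * (A $$ (0, k) * v k))"
      by (rule sum.cong) (use transv_mult_index[OF cA i] n0 in \<open>simp_all add: algebra_simps del: index_mult_mat\<close>)
    finally show ?thesis
      using transv_mult_index[OF cA i n0] n0
      by (simp add: sum.distrib sum_distrib_left del: index_mult_mat)
  qed
  \<comment> \<open>The values below \<open>n\<close> belong to the columns of \<open>A\<close>, and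
    \<open>f n\<close> to the conjugate.\<close>
  define f where "f c = (if c < n then g c else y)" for c
  have off: "p dvd A $$ (i, j)" if "\<forall>c\<le>n. p dvd f c" "i < n" "j < n" "i \<noteq> j" for p i j
  proof -
    have "p dvd g j" using that(1)[rule_format, of j] that(3) by (simp add: f_def)
    then show ?thesis using g(2)[of j i] that dvd_trans by blast
  qed
  have diag: "p dvd A $$ (0, 0) - A $$ (i, i)" if p: "\<forall>c\<le>n. p dvd f c" and i: "i < n" for p i
  proof (cases "i = 0")
    case False
    have row: "p dvd (\<Sum>k<n. A $$ (j, k) * v k) - A $$ (j, j) * v j" if j: "j < n" for j
    proof -
      have "(\<Sum>k<n. A $$ (j, k) * v k) = A $$ (j, j) * v j + (\<Sum>k\<in>{..<n} - {j}. A $$ (j, k) * v k)"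
        using j by (simp add: sum.remove)
      moreover have "p dvd (\<Sum>k\<in>{..<n} - {j}. A $$ (j, k) * v k)"
        by (rule dvd_sum) (use off[OF p j] in auto)
      ultimately show ?thesis by simp
    qed
    have "p dvd y" using p[rule_format, of n] by (simp add: f_def)
    then have "p dvd ?C $$ (i, 0)" using y(2)[OF i False] by (rule dvd_trans)
    then have 1: "p dvd A $$ (i, 0) + A $$ (0, 0)
      - (\<Sum>k<n. A $$ (i, k) * v k) - (\<Sum>k<n. A $$ (0, k) * v k)"
      unfolding C0[OF i] using False by (simp add: v_def)
    have 2: "p dvd (\<Sum>k<n. A $$ (i, k) * v k) - A $$ (i, i)"
      using row[OF i] False by (simp add: v_def)
    have 3: "p dvd (\<Sum>k<n. A $$ (0, k) * v k)"
      using row[OF n0] by (simp add: v_def)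
    have 4: "p dvd A $$ (i, 0)" using off[OF p i n0 False] .
    have "p dvd (A $$ (i, 0) + A $$ (0, 0) - (\<Sum>k<n. A $$ (i, k) * v k) - (\<Sum>k<n. A $$ (0, k) * v k))
        + ((\<Sum>k<n. A $$ (i, k) * v k) - A $$ (i, i)) + (\<Sum>k<n. A $$ (0, k) * v k) - A $$ (i, 0)"
      by (intro dvd_add dvd_diff 1 2 3 4)
    then show ?thesis by (simp add: algebra_simps)
  qed simp
  show ?thesis
    by (rule that[of f]) (use g y off diag in \<open>auto simp: f_def\<close>)
qed

section \<open>Generating the unit ideal and counting factors\<close>

lemma elementary_sum_cb:
  assumes "finite Y" "Y \<subseteq> level" and ij: "i < n" "j < n" "i \<noteq> j"
  shows "elementary n i j (\<Sum>y\<in>Y. y * h y) \<in> cb (4 * card Y)"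
  using assms(1,2)
proof (induction Y rule: finite_induct)
  case empty
  then show ?case using cb_one by (simp add: elementary_zero)
next
  case (insert y Y)
  have "elementary n i j (y * h y) * elementary n i j (\<Sum>y\<in>Y. y * h y) \<in> cb (4 + 4 * card Y)"
    by (rule cb_mult) (use insert ij levelD in auto)
  then show ?case
    using insert ij by (simp add: elementary_add)
qed

text \<open>A combination of \<open>Y\<close> that divides all of \<open>Y\<close> is divisible by
  no member of \<open>P\<close>, so it is a unit. Thus \<open>r\<close> is a combination of
  \<open>Y\<close>, and each term costs four factors.\<close>

lemma elementary_cb_level:
  assumes Y: "finite Y" "Y \<subseteq> level" and sep: "\<And>p. p \<in> P \<Longrightarrow> \<exists>y\<in>Y. \<not> p dvd y"
    and ij: "i < n" "j < n" "i \<noteq> j"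
  shows "elementary n i j r \<in> cb (4 * card Y)"
proof -
  \<comment> \<open>Starting from \<open>0\<close> makes the common divisor a combination of
    \<open>Y\<close> alone.\<close>
  obtain t where "\<forall>y\<in>Y. 0 + (\<Sum>y\<in>Y. t y * y) dvd y"
    using stable_range_finite[OF Y(1), of 0 "\<lambda>y. y"] by blast
  then have t: "(\<Sum>y\<in>Y. t y * y) dvd y" if "y \<in> Y" for y using that by simp
  have "\<not> p dvd (\<Sum>y\<in>Y. t y * y)" if "p \<in> P" for p
    using sep[OF that] t dvd_trans by blast
  then have "(\<Sum>y\<in>Y. t y * y) dvd 1" using non_unit[of "\<Sum>y\<in>Y. t y * y"] by blast
  then obtain u where "1 = (\<Sum>y\<in>Y. t y * y) * u" by (elim dvdE)
  then have "r = (\<Sum>y\<in>Y. t y * y) * (u * r)" by (metis mult.assoc mult_1_left)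
  also have "\<dots> = (\<Sum>y\<in>Y. y * (t y * u * r))"
    by (simp add: sum_distrib_left sum_distrib_right mult_ac)
  finally show ?thesis
    using elementary_sum_cb[OF Y ij, of "\<lambda>y. t y * u * r"] by simp
qed

text \<open>The constant \<open>12\<close> is three transvections for each of \<open>n - 1\<close>
  columns times four conjugates for each element of \<open>Y\<close>.\<close>

lemma SL_subset_cb_level:
  assumes "finite Y" "Y \<subseteq> level" "\<And>p. p \<in> P \<Longrightarrow> \<exists>y\<in>Y. \<not> p dvd y"
  shows "carrier (SL n) \<subseteq> cb (12 * (n - 1) * card Y)"
  using SL_subset_cb[of "4 * card Y", OF elementary_cb_level[OF assms]] by (simp add: mult_ac)

lemma SL_subset_cb_normally_generates:
  assumes gen: "normally_generates (SL n) S" and fin: "finite S"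
  shows "carrier (SL n) \<subseteq> cb (12 * (n - 1) * min (card P) (card S * (n + 1)))"
proof -
  have "\<exists>f. (\<forall>c\<le>n. f c \<in> level) \<and>
      (\<forall>p. (\<forall>c\<le>n. p dvd f c) \<longrightarrow> A \<in> central_mod n p)" if A: "A \<in> S" for A
  proof -
    obtain f where f: "\<And>c. c \<le> n \<Longrightarrow> f c \<in> level"
      "\<And>p i j. \<forall>c\<le>n. p dvd f c \<Longrightarrow> i < n \<Longrightarrow> j < n \<Longrightarrow> i \<noteq> j \<Longrightarrow> p dvd A $$ (i, j)"
      "\<And>p i. \<forall>c\<le>n. p dvd f c \<Longrightarrow> i < n \<Longrightarrow> p dvd A $$ (0, 0) - A $$ (i, i)"
      using level_separates[OF SL.mem_conj_ball[OF S A]] by blast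
    have "A \<in> central_mod n p" if "\<forall>c\<le>n. p dvd f c" for p
      by (rule scalar_mod_central) (use A S f(2,3)[OF that] in auto)
    then show ?thesis using f(1) by blast
  qed
  then obtain f where f: "\<And>A c. A \<in> S \<Longrightarrow> c \<le> n \<Longrightarrow> f A c \<in> level"
    "\<And>A p. A \<in> S \<Longrightarrow> \<forall>c\<le>n. p dvd f A c \<Longrightarrow> A \<in> central_mod n p" by metis
  define Y where "Y = (\<Union>A\<in>S. f A ` {..n})"
  have Y: "finite Y" "Y \<subseteq> level" using fin f(1) by (auto simp: Y_def)
  have "card Y \<le> (\<Sum>A\<in>S. card (f A ` {..n}))"
    unfolding Y_def by (rule card_UN_le[OF fin])
  also have "\<dots> \<le> (\<Sum>A\<in>S. n + 1)"
    by (intro sum_mono order.trans[OF card_image_le]) auto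
  finally have card_Y: "card Y \<le> card S * (n + 1)" by simp
  \<comment> \<open>If \<open>p\<close> divided all of \<open>Y\<close>, then \<open>S\<close> would
    lie in the proper normal subgroup \<open>central_mod n p\<close>.\<close>
  have sep: "\<exists>y\<in>Y. \<not> p dvd y" if p: "p \<in> P" for p
  proof (rule ccontr)
    assume "\<not> ?thesis"
    then have "p dvd f A c" if "A \<in> S" "c \<le> n" for A c
      using that unfolding Y_def by blast
    then have "S \<subseteq> central_mod n p" using f(2) by blast
    then have "normal_closure (SL n) S \<subseteq> central_mod n p"
      using central_mod_normal unfolding normal_closure_def by blast
    moreover have "elementary n 0 1 1 \<in> carrier (SL n :: 'a mat monoid)"
      unfolding elementary_def by (rule transv_row_SL) (use n in auto)
    ultimately have "elementary n 0 1 1 \<in> central_mod n p"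
      using gen unfolding normally_generates_def by blast
    then show False
      using elementary_not_central[of n p] not_dvd_one[OF p] n by simp
  qed
  show ?thesis
  proof (cases "card P \<le> card S * (n + 1)")
    case False
    then have "12 * (n - 1) * card Y \<le> 12 * (n - 1) * min (card P) (card S * (n + 1))"
      using card_Y by (intro mult_le_mono2) simp
    then show ?thesis using SL_subset_cb_level[OF Y sep] cb_mono by blast
  next
    case True
    \<comment> \<open>One witness for each member of \<open>P\<close> already separates, so at most
      \<open>card P\<close> elements of \<open>Y\<close> are kept.\<close>
    obtain y where y: "\<And>p. p \<in> P \<Longrightarrow> y p \<in> Y \<and> \<not> p dvd y p" using sep by metis
    have "carrier (SL n) \<subseteq> cb (12 * (n - 1) * card (y ` P))"
      by (rule SL_subset_cb_level) (use y Y finite_P in auto)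
    moreover have "12 * (n - 1) * card (y ` P) \<le> 12 * (n - 1) * min (card P) (card S * (n + 1))"
      using True card_image_le[OF finite_P, of y] by (intro mult_le_mono2) simp
    ultimately show ?thesis using cb_mono by blast
  qed
qed

end

text \<open>Column \<open>0\<close> has the off-diagonal entry \<open>1\<close>, so the element of
  \<open>level\<close> dividing it is a unit, and a one-element set separates all of
  \<open>P\<close>.\<close>

lemma (in semilocal_bezout) normally_generates_elementary:
  assumes n: "3 \<le> n"
  shows "normally_generates (SL n :: 'a mat monoid) {elementary n 1 0 1}"
proof -
  interpret SL_conj P n "{elementary n 1 0 1 :: 'a mat}"
    by unfold_locales (use n in \<open>auto simp: elementary_def intro!: transv_row_SL\<close>)
  have "elementary n 1 0 1 \<in> cb 1" by (rule SL.mem_conj_ball[OF S]) simp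
  then obtain x where x: "x \<in> level" "\<And>i. i < n \<Longrightarrow> i \<noteq> 0 \<Longrightarrow> x dvd elementary n 1 0 1 $$ (i, 0)"
    by (rule column_level) (use n in auto)
  have "elementary n 1 0 1 $$ (1, 0) = (1 :: 'a)" using n by (simp add: elementary_def)
  then have "x dvd 1" using x(2)[of 1] n by simp
  then have "carrier (SL n) \<subseteq> cb (12 * (n - 1) * card {x})"
    using x(1) not_dvd_one dvd_trans by (intro SL_subset_cb_level) blast+
  then show ?thesis by (rule SL.normally_generatesI[OF S])
qed

theorem theorem6p3:
  fixes n d :: nat
  assumes pid: "principal_domain (class_ring :: 'a :: idom ring)"
    and fin: "finite {M. maximalideal M (class_ring :: 'a ring)}"
    and d: "d = card {M. maximalideal M (class_ring :: 'a ring)}"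
    and n: "n \<ge> 3"
  shows "normally_generates (SL n :: 'a mat monoid) (EL n)
    \<and> (\<forall>k::nat. k \<ge> 1 \<longrightarrow>
          Delta_k k (SL n :: 'a mat monoid)
            \<le> ereal (12 * (real n - 1) * real (min d (k * (n + 1)))))
    \<and> Delta (SL n :: 'a mat monoid) \<le> ereal (12 * real d * (real n - 1))
    \<and> uniformly_bounded (SL n :: 'a mat monoid)"
proof -
  obtain P :: "'a set" where P: "semilocal_bezout P" and card_P: "card P \<le> d"
    using principal_domain_semilocal_bezout[OF pid fin] unfolding d .
  interpret semilocal_bezout P by fact
  interpret SL: group "SL n :: 'a mat monoid" by (rule group_SL)
  have gen: "normally_generates (SL n :: 'a mat monoid) {elementary n 1 0 1}"
    by (rule normally_generates_elementary[OF n])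
  \<comment> \<open>Generation passes from the single matrix to the larger set \<open>EL n\<close>;
    the singleton itself later witnesses finite normal generation.\<close>
  have "elementary n 1 0 1 \<in> (EL n :: 'a mat set)"
    using n unfolding EL_def elementary_eq_EL by fastforce
  then have EL: "normally_generates (SL n :: 'a mat monoid) (EL n)"
    using EL_subset_SL by (intro SL.normally_generates_mono[OF gen]) auto
  have bound: "conj_diameter (SL n) S \<le> ereal (12 * (real n - 1) * real (min d (k * (n + 1))))"
    if gen_S: "normally_generates (SL n) S" "finite S" "card S \<le> k" for S :: "'a mat set" and k
  proof -
    interpret SL_conj P n S
      by unfold_locales (use n gen_S in \<open>auto simp: normally_generates_def\<close>)
    have "conj_diameter (SL n) S \<le> ereal (real (12 * (n - 1) * min (card P) (card S * (n + 1))))"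
      by (rule conj_diameter_le[OF SL_subset_cb_normally_generates[OF gen_S(1,2)]])
    also have "min (card P) (card S * (n + 1)) \<le> min d (k * (n + 1))"
      by (rule min.mono[OF card_P mult_le_mono1[OF gen_S(3)]])
    then have "12 * (n - 1) * min (card P) (card S * (n + 1)) \<le> 12 * (n - 1) * min d (k * (n + 1))"
      by (rule mult_le_mono2)
    then have "ereal (real (12 * (n - 1) * min (card P) (card S * (n + 1))))
        \<le> ereal (real (12 * (n - 1) * min d (k * (n + 1))))"
      by (simp only: ereal_less_eq of_nat_le_iff)
    \<comment> \<open>Natural and real subtraction agree here because \<open>n\<close> is at least
      \<open>3\<close>.\<close>
    also have "real (12 * (n - 1) * min d (k * (n + 1))) = 12 * (real n - 1) * real (min d (k * (n + 1)))"
      using n by (simp only: of_nat_mult of_nat_diff of_nat_numeral of_nat_1)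
    finally show ?thesis .
  qed
  have Delta: "Delta (SL n :: 'a mat monoid) \<le> ereal (12 * real d * (real n - 1))"
    unfolding Delta_def
  proof (rule Sup_least, elim CollectE exE conjE)
    fix D and S :: "'a mat set"
    assume D: "D = conj_diameter (SL n) S" and S: "normally_generates (SL n) S" "finite S"
    \<comment> \<open>Taking \<open>k\<close> to be \<open>card S\<close> and then bounding the
      minimum by \<open>d\<close> makes the estimate independent of \<open>S\<close>.\<close>
    have "D \<le> ereal (12 * (real n - 1) * real (min d (card S * (n + 1))))"
      unfolding D by (rule bound[OF S order_refl])
    also have "\<dots> \<le> ereal (12 * (real n - 1) * real d)"
      unfolding ereal_less_eq by (rule mult_left_mono) (use n in auto)
    finally show "D \<le> ereal (12 * real d * (real n - 1))" by (simp add: mult_ac)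
  qed
  have "Delta_k k (SL n :: 'a mat monoid) \<le> ereal (12 * (real n - 1) * real (min d (k * (n + 1))))" for k
    unfolding Delta_k_def by (rule Sup_least) (use bound in blast)
  moreover have "uniformly_bounded (SL n :: 'a mat monoid)"
  proof -
    have "Delta (SL n :: 'a mat monoid) < \<infinity>"
      using Delta by (rule le_less_trans) simp
    then show ?thesis
      using gen unfolding uniformly_bounded_def finitely_normally_generated_def by blast
  qed
  ultimately show ?thesis using EL Delta by blast
qed

end
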